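(* Let $\mathcal{C}$ be an additive, symmetric monoidal, ordinary $1$-category with unit $\mathbb{1}$, let $G \in \mathcal{C}$ and let $\mathbb{1} \xrightarrow{i} G \xrightarrow{p} \mathbb{1}$ be a retraction (so $p i = \mathrm{id}_{\mathbb{1}}$) which admits a complement $\bar G$ (so $G \simeq \mathbb{1} \oplus \bar G$ compatibly with $i$ and $p$). Assume that $\Sigma_G := G \otimes (-)$ admits a right adjoint $\Omega_G$. Suppose given a set $\mathscr{S}$ of objects of $\mathcal{C}$ with $\mathbb{1} \in \mathscr{S}$ and closed under tensor products with $G$, as well as for each $X \in \mathscr{S}$ a map $$\rho_X: \Omega_G \Sigma_G X \to X.$$ Assume that the following hold. (1) For $X \in \mathscr{S}$, the following two maps $G \otimes \Omega_G\Sigma_G X \to G \otimes X$ agree: the map $G \otimes \rho_X$, and the composite $$G \otimes \Omega_G\Sigma_G X \to \Omega_G\Sigma_G(G \otimes X) \xrightarrow{\rho_{G \otimes X}} G \otimes X,$$ where the first map is the case $A = G$ of the general map $A \otimes \Omega_G\Sigma_G X \to \Omega_G\Sigma_G(A \otimes X)$ adjoint to $\Sigma_G A \otimes \Omega_G \Sigma_G X \simeq A \otimes \Sigma_G\Omega_G\Sigma_G X \to A \otimes \Sigma_G X \simeq \Sigma_G A \otimes X$ (the middle arrow being induced by the counit). (2) For $X \in \mathscr{S}$, one has $$(i \otimes X) \circ \rho_X = \rho_{G \otimes X} \circ \Omega_G\Sigma_G(i \otimes X): \Omega_G\Sigma_G X \to G \otimes X$$ and $$(p \otimes X) \circ \rho_{G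 \otimes X} = \rho_X \circ \Omega_G\Sigma_G(p \otimes X): \Omega_G\Sigma_G(G \otimes X) \to X.$$ (3) For $X \in \mathscr{S}$, the composite $$X \xrightarrow{\bar u} \Omega_{\bar G}\Sigma_{\bar G} X \subset \Omega_G\Sigma_G X \xrightarrow{\rho_X} X$$ is the identity. (4) The object $\bar G$ is symmetric, i.e. for some $n \ge 2$ the cyclic permutation on $\bar G^{\otimes n}$ is the identity. Then for all $X \in \mathscr{S}$ the unit map $X \xrightarrow{\bar u} \Omega_{\bar G}\Sigma_{\bar G} X$ is an equivalence (i.e. an isomorphism).
   Context: The tensor product of $\mathcal{C}$ is additive in each variable. $\Sigma_{\bar G} = \bar G \otimes (-)$ and $\Omega_{\bar G}$ denotes its right adjoint, the complement of $\mathrm{id}$ in $\Omega_G$ arising from the decomposition $G \simeq \mathbb{1} \oplus \bar G$; $\bar u$ denotes the unit of the adjunction $\Sigma_{\bar G} \dashv \Omega_{\bar G}$. The inclusion $\Omega_{\bar G}\Sigma_{\bar G} X \subset \Omega_G\Sigma_G X$ is the inclusion of a direct summand induced by the projection $G \to \bar G$ (inducing $\Omega_{\bar G} \to \Omega_G$) and the inclusion $\bar G \to G$ (inducing $\Sigma_{\bar G} \to \Sigma_G$). *)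

theory Defs
  imports "HOL-Algebra.Group"
begin

section \<open>Categories\<close>

text \<open>
  Objects and morphisms live in sets \<open>ob C\<close> and \<open>ar C\<close> of arbitrary types. The operations are total
  HOL functions, but the axioms only constrain them on objects and on composable morphisms.
  Composition is written in the usual order: \<open>g \<cdot> f\<close> is \<open>g\<close> after \<open>f\<close>.
\<close>

record ('o, 'm) category_data =
  ob :: "'o set"
  ar :: "'m set"
  Dom :: "'m \<Rightarrow> 'o"
  Cod :: "'m \<Rightarrow> 'o"
  ident :: "'o \<Rightarrow> 'm"  ("id\<^sub>m\<index>")
  cmp :: "'m \<Rightarrow> 'm \<Rightarrow> 'm"  (infixr "\<cdot>\<index>" 65)

definition Hom :: "('o, 'm, 'x) category_data_scheme \<Rightarrow> 'o \<Rightarrow> 'o \<Rightarrow> 'm set"  ("Hom\<index>")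
  where "Hom\<^bsub>C\<^esub> X Y = {f \<in> ar C. Dom C f = X \<and> Cod C f = Y}"

locale category =
  fixes C :: "('o, 'm, 'x) category_data_scheme" (structure)
  assumes Dom_ob: "f \<in> ar C \<Longrightarrow> Dom C f \<in> ob C"
    and Cod_ob: "f \<in> ar C \<Longrightarrow> Cod C f \<in> ob C"
    and ident_Hom: "X \<in> ob C \<Longrightarrow> id\<^sub>m X \<in> Hom X X"
    and cmp_Hom: "\<lbrakk>f \<in> Hom X Y; g \<in> Hom Y Z\<rbrakk> \<Longrightarrow> g \<cdot> f \<in> Hom X Z"
    and ident_left: "f \<in> Hom X Y \<Longrightarrow> id\<^sub>m Y \<cdot> f = f"
    and ident_right: "f \<in> Hom X Y \<Longrightarrow> f \<cdot> id\<^sub>m X = f"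
    and cmp_assoc: "\<lbrakk>f \<in> Hom W X; g \<in> Hom X Y; h \<in> Hom Y Z\<rbrakk> \<Longrightarrow> (h \<cdot> g) \<cdot> f = h \<cdot> (g \<cdot> f)"

definition inverse_ar :: "('o, 'm, 'x) category_data_scheme \<Rightarrow> 'm \<Rightarrow> 'm \<Rightarrow> bool"
  where "inverse_ar C f g \<longleftrightarrow>
    g \<in> Hom\<^bsub>C\<^esub> (Cod C f) (Dom C f) \<and>
    g \<cdot>\<^bsub>C\<^esub> f = id\<^sub>m\<^bsub>C\<^esub> (Dom C f) \<and> f \<cdot>\<^bsub>C\<^esub> g = id\<^sub>m\<^bsub>C\<^esub> (Cod C f)"

definition is_isomorphism :: "('o, 'm, 'x) category_data_scheme \<Rightarrow> 'm \<Rightarrow> bool"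
  where "is_isomorphism C f \<longleftrightarrow> f \<in> ar C \<and> (\<exists>g. inverse_ar C f g)"

definition inv_ar :: "('o, 'm, 'x) category_data_scheme \<Rightarrow> 'm \<Rightarrow> 'm"
  where "inv_ar C f = (THE g. inverse_ar C f g)"


section \<open>Functors and adjunctions\<close>

record ('o, 'm, 'p, 'n) functor_data =
  on_ob :: "'o \<Rightarrow> 'p"
  on_ar :: "'m \<Rightarrow> 'n"

locale cat_functor = C: category C + D: category D
  for C :: "('o, 'm, 'x) category_data_scheme"
    and D :: "('p, 'n, 'y) category_data_scheme" +
  fixes F :: "('o, 'm, 'p, 'n) functor_data"
  assumes on_ob: "X \<in> ob C \<Longrightarrow> on_ob F X \<in> ob D"
    and on_ar: "f \<in> Hom\<^bsub>C\<^esub> X Y \<Longrightarrow> on_ar F f \<in> Hom\<^bsub>D\<^esub> (on_ob F X) (on_ob F Y)"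
    and on_ident: "X \<in> ob C \<Longrightarrow> on_ar F (id\<^sub>m\<^bsub>C\<^esub> X) = id\<^sub>m\<^bsub>D\<^esub> (on_ob F X)"
    and on_cmp: "\<lbrakk>f \<in> Hom\<^bsub>C\<^esub> X Y; g \<in> Hom\<^bsub>C\<^esub> Y Z\<rbrakk> \<Longrightarrow>
      on_ar F (g \<cdot>\<^bsub>C\<^esub> f) = on_ar F g \<cdot>\<^bsub>D\<^esub> on_ar F f"

text \<open>\<open>L\<close> is left adjoint to \<open>R\<close>, with unit \<open>\<eta>\<close> and counit \<open>\<epsilon>\<close>.\<close>

locale adjunction = L: cat_functor C D L + R: cat_functor D C R
  for C :: "('o, 'm, 'x) category_data_scheme"
    and D :: "('p, 'n, 'y) category_data_scheme"
    and L :: "('o, 'm, 'p, 'n) functor_data"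
    and R :: "('p, 'n, 'o, 'm) functor_data" +
  fixes \<eta> :: "'o \<Rightarrow> 'm" and \<epsilon> :: "'p \<Rightarrow> 'n"
  assumes unit_Hom: "X \<in> ob C \<Longrightarrow> \<eta> X \<in> Hom\<^bsub>C\<^esub> X (on_ob R (on_ob L X))"
    and unit_natural: "f \<in> Hom\<^bsub>C\<^esub> X X' \<Longrightarrow> \<eta> X' \<cdot>\<^bsub>C\<^esub> f = on_ar R (on_ar L f) \<cdot>\<^bsub>C\<^esub> \<eta> X"
    and counit_Hom: "Y \<in> ob D \<Longrightarrow> \<epsilon> Y \<in> Hom\<^bsub>D\<^esub> (on_ob L (on_ob R Y)) Y"
    and counit_natural: "g \<in> Hom\<^bsub>D\<^esub> Y Y' \<Longrightarrow> \<epsilon> Y' \<cdot>\<^bsub>D\<^esub> on_ar L (on_ar R g) = g \<cdot>\<^bsub>D\<^esub> \<epsilon> Y"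
    and triangle_L: "X \<in> ob C \<Longrightarrow> \<epsilon> (on_ob L X) \<cdot>\<^bsub>D\<^esub> on_ar L (\<eta> X) = id\<^sub>m\<^bsub>D\<^esub> (on_ob L X)"
    and triangle_R: "Y \<in> ob D \<Longrightarrow> on_ar R (\<epsilon> Y) \<cdot>\<^bsub>C\<^esub> \<eta> (on_ob R Y) = id\<^sub>m\<^bsub>C\<^esub> (on_ob R Y)"

text \<open>The morphism \<open>A \<rightarrow> R Y\<close> adjoint to \<open>h : L A \<rightarrow> Y\<close>.\<close>

definition adjunct ::
    "('o, 'm, 'x) category_data_scheme \<Rightarrow> ('p, 'n, 'o, 'm) functor_data \<Rightarrow> ('o \<Rightarrow> 'm) \<Rightarrow> 'o \<Rightarrow> 'n \<Rightarrow> 'm"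
  where "adjunct C R \<eta> A h = on_ar R h \<cdot>\<^bsub>C\<^esub> \<eta> A"


section \<open>Additive categories\<close>

record ('o, 'm) additive_data = "('o, 'm) category_data" +
  zero_ar :: "'o \<Rightarrow> 'o \<Rightarrow> 'm"
  add_ar :: "'m \<Rightarrow> 'm \<Rightarrow> 'm"  (infixl "\<oplus>\<^sub>m\<index>" 60)

definition hom_group :: "('o, 'm, 'x) additive_data_scheme \<Rightarrow> 'o \<Rightarrow> 'o \<Rightarrow> 'm monoid"
  where "hom_group C X Y =
    \<lparr>carrier = Hom\<^bsub>C\<^esub> X Y, mult = add_ar C, one = zero_ar C X Y\<rparr>"

text \<open>
  \<open>B\<close> is the direct sum of \<open>X\<close> and \<open>Y\<close>, with inclusions \<open>i\<close>, \<open>j\<close> and projections \<open>p\<close>, \<open>q\<close>.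
\<close>

definition is_biproduct ::
    "('o, 'm, 'x) additive_data_scheme \<Rightarrow> 'o \<Rightarrow> 'o \<Rightarrow> 'o \<Rightarrow> 'm \<Rightarrow> 'm \<Rightarrow> 'm \<Rightarrow> 'm \<Rightarrow> bool"
  where "is_biproduct C X Y B i p j q \<longleftrightarrow>
    i \<in> Hom\<^bsub>C\<^esub> X B \<and> p \<in> Hom\<^bsub>C\<^esub> B X \<and> j \<in> Hom\<^bsub>C\<^esub> Y B \<and> q \<in> Hom\<^bsub>C\<^esub> B Y \<and>
    p \<cdot>\<^bsub>C\<^esub> i = id\<^sub>m\<^bsub>C\<^esub> X \<and> q \<cdot>\<^bsub>C\<^esub> j = id\<^sub>m\<^bsub>C\<^esub> Y \<and>
    p \<cdot>\<^bsub>C\<^esub> j = zero_ar C Y X \<and> q \<cdot>\<^bsub>C\<^esub> i = zero_ar C X Y \<and>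
    (i \<cdot>\<^bsub>C\<^esub> p) \<oplus>\<^sub>m\<^bsub>C\<^esub> (j \<cdot>\<^bsub>C\<^esub> q) = id\<^sub>m\<^bsub>C\<^esub> B"

definition is_zero_object :: "('o, 'm, 'x) category_data_scheme \<Rightarrow> 'o \<Rightarrow> bool"
  where "is_zero_object C Z \<longleftrightarrow> Z \<in> ob C \<and>
    (\<forall>X\<in>ob C. (\<exists>!f. f \<in> Hom\<^bsub>C\<^esub> X Z) \<and> (\<exists>!f. f \<in> Hom\<^bsub>C\<^esub> Z X))"

locale additive_category = category C
  for C :: "('o, 'm, 'x) additive_data_scheme" (structure) +
  assumes hom_group: "\<lbrakk>X \<in> ob C; Y \<in> ob C\<rbrakk> \<Longrightarrow> comm_group (hom_group C X Y)"
    and cmp_add_left: "\<lbrakk>f \<in> Hom X Y; g \<in> Hom Y Z; g' \<in> Hom Y Z\<rbrakk> \<Longrightarrow>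
      (g \<oplus>\<^sub>m g') \<cdot> f = (g \<cdot> f) \<oplus>\<^sub>m (g' \<cdot> f)"
    and cmp_add_right: "\<lbrakk>f \<in> Hom X Y; f' \<in> Hom X Y; g \<in> Hom Y Z\<rbrakk> \<Longrightarrow>
      g \<cdot> (f \<oplus>\<^sub>m f') = (g \<cdot> f) \<oplus>\<^sub>m (g \<cdot> f')"
    and zero_object: "\<exists>Z. is_zero_object C Z"
    and biproducts: "\<lbrakk>X \<in> ob C; Y \<in> ob C\<rbrakk> \<Longrightarrow> \<exists>B i p j q. is_biproduct C X Y B i p j q"


section \<open>Additive symmetric monoidal categories\<close>

record ('o, 'm) tensor_data = "('o, 'm) additive_data" +
  tensor_unit :: 'o  ("\<I>\<index>")
  tensor_ob :: "'o \<Rightarrow> 'o \<Rightarrow> 'o"  (infixr "\<otimes>\<^sub>o\<index>" 75)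
  tensor_ar :: "'m \<Rightarrow> 'm \<Rightarrow> 'm"  (infixr "\<otimes>\<^sub>m\<index>" 75)
  associator :: "'o \<Rightarrow> 'o \<Rightarrow> 'o \<Rightarrow> 'm"
  left_unitor :: "'o \<Rightarrow> 'm"
  right_unitor :: "'o \<Rightarrow> 'm"
  braiding :: "'o \<Rightarrow> 'o \<Rightarrow> 'm"

locale additive_symmetric_monoidal_category = additive_category C
  for C :: "('o, 'm, 'x) tensor_data_scheme" (structure) +
  assumes unit_ob: "\<I> \<in> ob C"
    and tensor_ob: "\<lbrakk>X \<in> ob C; Y \<in> ob C\<rbrakk> \<Longrightarrow> X \<otimes>\<^sub>o Y \<in> ob C"
    and tensor_ar: "\<lbrakk>f \<in> Hom X X'; g \<in> Hom Y Y'\<rbrakk> \<Longrightarrow>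
      f \<otimes>\<^sub>m g \<in> Hom (X \<otimes>\<^sub>o Y) (X' \<otimes>\<^sub>o Y')"
    and tensor_ident: "\<lbrakk>X \<in> ob C; Y \<in> ob C\<rbrakk> \<Longrightarrow> id\<^sub>m X \<otimes>\<^sub>m id\<^sub>m Y = id\<^sub>m (X \<otimes>\<^sub>o Y)"
    and tensor_cmp: "\<lbrakk>f \<in> Hom X X'; f' \<in> Hom X' X''; g \<in> Hom Y Y'; g' \<in> Hom Y' Y''\<rbrakk> \<Longrightarrow>
      (f' \<cdot> f) \<otimes>\<^sub>m (g' \<cdot> g) = (f' \<otimes>\<^sub>m g') \<cdot> (f \<otimes>\<^sub>m g)"
    and assoc_Hom: "\<lbrakk>X \<in> ob C; Y \<in> ob C; Z \<in> ob C\<rbrakk> \<Longrightarrow>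
      associator C X Y Z \<in> Hom ((X \<otimes>\<^sub>o Y) \<otimes>\<^sub>o Z) (X \<otimes>\<^sub>o (Y \<otimes>\<^sub>o Z))"
    and assoc_iso: "\<lbrakk>X \<in> ob C; Y \<in> ob C; Z \<in> ob C\<rbrakk> \<Longrightarrow> is_isomorphism C (associator C X Y Z)"
    and assoc_natural: "\<lbrakk>f \<in> Hom X X'; g \<in> Hom Y Y'; h \<in> Hom Z Z'\<rbrakk> \<Longrightarrow>
      associator C X' Y' Z' \<cdot> ((f \<otimes>\<^sub>m g) \<otimes>\<^sub>m h) = (f \<otimes>\<^sub>m (g \<otimes>\<^sub>m h)) \<cdot> associator C X Y Z"
    and lunit_Hom: "X \<in> ob C \<Longrightarrow> left_unitor C X \<in> Hom (\<I> \<otimes>\<^sub>o X) X"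
    and lunit_iso: "X \<in> ob C \<Longrightarrow> is_isomorphism C (left_unitor C X)"
    and lunit_natural: "f \<in> Hom X X' \<Longrightarrow> left_unitor C X' \<cdot> (id\<^sub>m \<I> \<otimes>\<^sub>m f) = f \<cdot> left_unitor C X"
    and runit_Hom: "X \<in> ob C \<Longrightarrow> right_unitor C X \<in> Hom (X \<otimes>\<^sub>o \<I>) X"
    and runit_iso: "X \<in> ob C \<Longrightarrow> is_isomorphism C (right_unitor C X)"
    and runit_natural: "f \<in> Hom X X' \<Longrightarrow> right_unitor C X' \<cdot> (f \<otimes>\<^sub>m id\<^sub>m \<I>) = f \<cdot> right_unitor C X"
    and pentagon: "\<lbrakk>W \<in> ob C; X \<in> ob C; Y \<in> ob C; Z \<in> ob C\<rbrakk> \<Longrightarrow>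
      associator C W X (Y \<otimes>\<^sub>o Z) \<cdot> associator C (W \<otimes>\<^sub>o X) Y Z =
      (id\<^sub>m W \<otimes>\<^sub>m associator C X Y Z) \<cdot> associator C W (X \<otimes>\<^sub>o Y) Z \<cdot> (associator C W X Y \<otimes>\<^sub>m id\<^sub>m Z)"
    and triangle: "\<lbrakk>X \<in> ob C; Y \<in> ob C\<rbrakk> \<Longrightarrow>
      (id\<^sub>m X \<otimes>\<^sub>m left_unitor C Y) \<cdot> associator C X \<I> Y = right_unitor C X \<otimes>\<^sub>m id\<^sub>m Y"
    and braid_Hom: "\<lbrakk>X \<in> ob C; Y \<in> ob C\<rbrakk> \<Longrightarrow> braiding C X Y \<in> Hom (X \<otimes>\<^sub>o Y) (Y \<otimes>\<^sub>o X)"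
    and braid_natural: "\<lbrakk>f \<in> Hom X X'; g \<in> Hom Y Y'\<rbrakk> \<Longrightarrow>
      braiding C X' Y' \<cdot> (f \<otimes>\<^sub>m g) = (g \<otimes>\<^sub>m f) \<cdot> braiding C X Y"
    and braid_symmetric: "\<lbrakk>X \<in> ob C; Y \<in> ob C\<rbrakk> \<Longrightarrow> braiding C Y X \<cdot> braiding C X Y = id\<^sub>m (X \<otimes>\<^sub>o Y)"
    and hexagon: "\<lbrakk>X \<in> ob C; Y \<in> ob C; Z \<in> ob C\<rbrakk> \<Longrightarrow>
      associator C Y Z X \<cdot> braiding C X (Y \<otimes>\<^sub>o Z) \<cdot> associator C X Y Z =
      (id\<^sub>m Y \<otimes>\<^sub>m braiding C X Z) \<cdot> associator C Y X Z \<cdot> (braiding C X Y \<otimes>\<^sub>m id\<^sub>m Z)"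
    and tensor_add_left: "\<lbrakk>f \<in> Hom X X'; f' \<in> Hom X X'; g \<in> Hom Y Y'\<rbrakk> \<Longrightarrow>
      (f \<oplus>\<^sub>m f') \<otimes>\<^sub>m g = (f \<otimes>\<^sub>m g) \<oplus>\<^sub>m (f' \<otimes>\<^sub>m g)"
    and tensor_add_right: "\<lbrakk>f \<in> Hom X X'; g \<in> Hom Y Y'; g' \<in> Hom Y Y'\<rbrakk> \<Longrightarrow>
      f \<otimes>\<^sub>m (g \<oplus>\<^sub>m g') = (f \<otimes>\<^sub>m g) \<oplus>\<^sub>m (f \<otimes>\<^sub>m g')"


section \<open>Suspensions and the comparison maps\<close>

text \<open>The endofunctor \<open>\<Sigma>\<^sub>A = A \<otimes> (-)\<close>.\<close>

definition Susp :: "('o, 'm, 'x) tensor_data_scheme \<Rightarrow> 'o \<Rightarrow> ('o, 'm, 'o, 'm) functor_data"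
  where "Susp C A = \<lparr>on_ob = \<lambda>X. A \<otimes>\<^sub>o\<^bsub>C\<^esub> X, on_ar = \<lambda>f. id\<^sub>m\<^bsub>C\<^esub> A \<otimes>\<^sub>m\<^bsub>C\<^esub> f\<rparr>"

text \<open>The symmetry isomorphism \<open>A \<otimes> (B \<otimes> X) \<rightarrow> B \<otimes> (A \<otimes> X)\<close>.\<close>

definition swap_left :: "('o, 'm, 'x) tensor_data_scheme \<Rightarrow> 'o \<Rightarrow> 'o \<Rightarrow> 'o \<Rightarrow> 'm"
  where "swap_left C A B X =
    associator C B A X \<cdot>\<^bsub>C\<^esub> (braiding C A B \<otimes>\<^sub>m\<^bsub>C\<^esub> id\<^sub>m\<^bsub>C\<^esub> X) \<cdot>\<^bsub>C\<^esub> inv_ar C (associator C A B X)"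

text \<open>
  The map \<open>A \<otimes> \<Omega>\<^sub>G \<Sigma>\<^sub>G X \<rightarrow> \<Omega>\<^sub>G \<Sigma>\<^sub>G (A \<otimes> X)\<close> adjoint to
  \<open>G \<otimes> (A \<otimes> \<Omega>\<^sub>G \<Sigma>\<^sub>G X) \<simeq> A \<otimes> (G \<otimes> \<Omega>\<^sub>G \<Sigma>\<^sub>G X) \<rightarrow> A \<otimes> (G \<otimes> X) \<simeq> G \<otimes> (A \<otimes> X)\<close>,
  where \<open>\<Omega>\<close>, \<open>\<eta>\<close>, \<open>\<epsilon>\<close> are the right adjoint of \<open>\<Sigma>\<^sub>G\<close> and the unit and counit of the adjunction.
\<close>

definition tensor_exchange ::
    "('o, 'm, 'x) tensor_data_scheme \<Rightarrow> 'o \<Rightarrow> ('o, 'm, 'o, 'm) functor_data \<Rightarrow>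
      ('o \<Rightarrow> 'm) \<Rightarrow> ('o \<Rightarrow> 'm) \<Rightarrow> 'o \<Rightarrow> 'o \<Rightarrow> 'm"
  where "tensor_exchange C G \<Omega> \<eta> \<epsilon> A X =
    (let Y = on_ob \<Omega> (G \<otimes>\<^sub>o\<^bsub>C\<^esub> X)
     in adjunct C \<Omega> \<eta> (A \<otimes>\<^sub>o\<^bsub>C\<^esub> Y)
          (swap_left C A G X \<cdot>\<^bsub>C\<^esub> (id\<^sub>m\<^bsub>C\<^esub> A \<otimes>\<^sub>m\<^bsub>C\<^esub> \<epsilon> (G \<otimes>\<^sub>o\<^bsub>C\<^esub> X)) \<cdot>\<^bsub>C\<^esub> swap_left C G A Y))"

text \<open>
  For \<open>i : \<I> \<rightarrow> G\<close> and \<open>p : G \<rightarrow> \<I>\<close>, the maps \<open>i \<otimes> X : X \<simeq> \<I> \<otimes> X \<rightarrow> G \<otimes> X\<close> and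
  \<open>p \<otimes> X : G \<otimes> X \<rightarrow> \<I> \<otimes> X \<simeq> X\<close>.
\<close>

definition from_unit :: "('o, 'm, 'x) tensor_data_scheme \<Rightarrow> 'm \<Rightarrow> 'o \<Rightarrow> 'm"
  where "from_unit C i X = (i \<otimes>\<^sub>m\<^bsub>C\<^esub> id\<^sub>m\<^bsub>C\<^esub> X) \<cdot>\<^bsub>C\<^esub> inv_ar C (left_unitor C X)"

definition to_unit :: "('o, 'm, 'x) tensor_data_scheme \<Rightarrow> 'm \<Rightarrow> 'o \<Rightarrow> 'm"
  where "to_unit C p X = left_unitor C X \<cdot>\<^bsub>C\<^esub> (p \<otimes>\<^sub>m\<^bsub>C\<^esub> id\<^sub>m\<^bsub>C\<^esub> X)"

text \<open>
  Let \<open>\<Omega>\<close> (with unit \<open>\<eta>\<close>) be right adjoint to \<open>\<Sigma>\<^sub>G\<close> and \<open>\<Omega>'\<close> (with counit \<open>\<epsilon>'\<close>) right adjoint to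
  \<open>\<Sigma>\<^sub>H\<close>. A map \<open>q : G \<rightarrow> H\<close> induces \<open>\<Sigma>\<^sub>G \<rightarrow> \<Sigma>\<^sub>H\<close>, hence by passing to right adjoints
  \<open>\<Omega>' Y \<rightarrow> \<Omega> Y\<close>: the map adjoint to \<open>G \<otimes> \<Omega>' Y \<rightarrow> H \<otimes> \<Omega>' Y \<rightarrow> Y\<close>.
\<close>

definition loop_map ::
    "('o, 'm, 'x) tensor_data_scheme \<Rightarrow> ('o, 'm, 'o, 'm) functor_data \<Rightarrow> ('o \<Rightarrow> 'm) \<Rightarrow>
      ('o, 'm, 'o, 'm) functor_data \<Rightarrow> ('o \<Rightarrow> 'm) \<Rightarrow> 'm \<Rightarrow> 'o \<Rightarrow> 'm"
  where "loop_map C \<Omega> \<eta> \<Omega>' \<epsilon>' q Y =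
    adjunct C \<Omega> \<eta> (on_ob \<Omega>' Y) (\<epsilon>' Y \<cdot>\<^bsub>C\<^esub> (q \<otimes>\<^sub>m\<^bsub>C\<^esub> id\<^sub>m\<^bsub>C\<^esub> (on_ob \<Omega>' Y)))"

text \<open>
  The map \<open>\<Omega>' \<Sigma>\<^sub>H X \<rightarrow> \<Omega> \<Sigma>\<^sub>H X \<rightarrow> \<Omega> \<Sigma>\<^sub>G X\<close> induced by \<open>q : G \<rightarrow> H\<close> and \<open>j : H \<rightarrow> G\<close>.
\<close>

definition summand_inclusion ::
    "('o, 'm, 'x) tensor_data_scheme \<Rightarrow> ('o, 'm, 'o, 'm) functor_data \<Rightarrow> ('o \<Rightarrow> 'm) \<Rightarrow> 'o \<Rightarrow>
      ('o, 'm, 'o, 'm) functor_data \<Rightarrow> ('o \<Rightarrow> 'm) \<Rightarrow> 'm \<Rightarrow> 'm \<Rightarrow> 'o \<Rightarrow> 'm"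
  where "summand_inclusion C \<Omega> \<eta> H \<Omega>' \<epsilon>' j q X =
    on_ar \<Omega> (j \<otimes>\<^sub>m\<^bsub>C\<^esub> id\<^sub>m\<^bsub>C\<^esub> X) \<cdot>\<^bsub>C\<^esub> loop_map C \<Omega> \<eta> \<Omega>' \<epsilon>' q (H \<otimes>\<^sub>o\<^bsub>C\<^esub> X)"


section \<open>Symmetric objects\<close>

primrec tensor_power :: "('o, 'm, 'x) tensor_data_scheme \<Rightarrow> 'o \<Rightarrow> nat \<Rightarrow> 'o"
  where
    "tensor_power C X 0 = \<I>\<^bsub>C\<^esub>"
  | "tensor_power C X (Suc n) = X \<otimes>\<^sub>o\<^bsub>C\<^esub> tensor_power C X n"

text \<open>The coherence isomorphism \<open>X\<^bsup>\<otimes>n\<^esup> \<otimes> X \<rightarrow> X\<^bsup>\<otimes>(n+1)\<^esup>\<close> which does not permute the factors.\<close>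

primrec append_factor :: "('o, 'm, 'x) tensor_data_scheme \<Rightarrow> 'o \<Rightarrow> nat \<Rightarrow> 'm"
  where
    "append_factor C X 0 = inv_ar C (right_unitor C X) \<cdot>\<^bsub>C\<^esub> left_unitor C X"
  | "append_factor C X (Suc n) =
      (id\<^sub>m\<^bsub>C\<^esub> X \<otimes>\<^sub>m\<^bsub>C\<^esub> append_factor C X n) \<cdot>\<^bsub>C\<^esub> associator C X (tensor_power C X n) X"

text \<open>
  The cyclic permutation of \<open>X\<^bsup>\<otimes>n\<^esup>\<close> moving the first factor to the last place. (Moving the last
  factor to the first place gives the inverse map.)
\<close>

fun cyclic_perm :: "('o, 'm, 'x) tensor_data_scheme \<Rightarrow> 'o \<Rightarrow> nat \<Rightarrow> 'm"
  where
    "cyclic_perm C X 0 = id\<^sub>m\<^bsub>C\<^esub> \<I>\<^bsub>C\<^esub>"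
  | "cyclic_perm C X (Suc n) = append_factor C X n \<cdot>\<^bsub>C\<^esub> braiding C X (tensor_power C X n)"

definition symmetric_object :: "('o, 'm, 'x) tensor_data_scheme \<Rightarrow> 'o \<Rightarrow> bool"
  where "symmetric_object C X \<longleftrightarrow>
    (\<exists>n\<ge>2. cyclic_perm C X n = id\<^sub>m\<^bsub>C\<^esub> (tensor_power C X n))"

end

theory Submission
  imports Defs
begin

text \<open>
  Write \<open>T = \<Omega>\<^sub>H \<Sigma>\<^sub>H\<close> with \<open>H\<close> the complement of the unit in \<open>G\<close>, and let \<open>r X : T X \<rightarrow> X\<close> be the
  restriction of \<open>\<rho> X\<close> to the summand \<open>T X\<close>. Then \<open>r X \<cdot> \<eta> X = id\<close>, and \<open>\<eta> X \<cdot> r X = id\<close> holds as soon as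
  \<open>H \<otimes> r X\<close> is the counit \<open>\<epsilon> (H \<otimes> X)\<close>. Iterating the first hypothesis and restricting along the split
  monomorphism \<open>H\<^sup>k \<otimes> X \<rightarrow> G\<^sup>k \<otimes> X\<close> expresses \<open>H\<^sup>k \<otimes> r X\<close> through the exchange map
  \<open>H\<^sup>k \<otimes> T X \<rightarrow> T (H\<^sup>k \<otimes> X)\<close>. The transpose of that map is \<open>H\<^sup>k \<otimes> \<epsilon> (H \<otimes> X)\<close> conjugated by
  cyclic permutations of \<open>H\<^sup>k\<^sup>+\<^sup>1\<close>. If these are trivial, the exchange map factors through the unit, and
  \<open>H\<^sup>k \<otimes> r X = H\<^sup>k\<^sup>-\<^sup>1 \<otimes> \<epsilon> (H \<otimes> X)\<close>. Finally \<open>H\<^sup>k\<^sup>-\<^sup>1 \<otimes> (-)\<close> can be cancelled, because the units at the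
  objects \<open>H\<^sup>m \<otimes> X\<close> are monomorphisms.
\<close>

section \<open>Calculus of arrows\<close>

context category
begin

lemma HomD:
  assumes "f \<in> Hom X Y"
  shows "f \<in> ar C" "Dom C f = X" "Cod C f = Y" "X \<in> ob C" "Y \<in> ob C"
  using assms Dom_ob Cod_ob by (auto simp: Hom_def)

lemma HomI: "\<lbrakk>f \<in> ar C; Dom C f = X; Cod C f = Y\<rbrakk> \<Longrightarrow> f \<in> Hom X Y"
  by (simp add: Hom_def)

lemma ob_Dom_Cod [simp]: "f \<in> ar C \<Longrightarrow> Dom C f \<in> ob C" "f \<in> ar C \<Longrightarrow> Cod C f \<in> ob C"
  by (rule Dom_ob Cod_ob; assumption)+

lemma ident_ar [simp]:
  assumes "X \<in> ob C"
  shows "id\<^sub>m X \<in> ar C" "Dom C (id\<^sub>m X) = X" "Cod C (id\<^sub>m X) = X"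
  using HomD[OF ident_Hom[OF assms]] by auto

lemma cmp_ar [simp]:
  assumes "f \<in> ar C" "g \<in> ar C" "Cod C f = Dom C g"
  shows "g \<cdot> f \<in> ar C" "Dom C (g \<cdot> f) = Dom C f" "Cod C (g \<cdot> f) = Cod C g"
  using HomD[OF cmp_Hom[of f "Dom C f" "Dom C g" g "Cod C g"]] assms by (auto simp: Hom_def)

lemma cmp_ident [simp]:
  "\<lbrakk>f \<in> ar C; Cod C f = Y\<rbrakk> \<Longrightarrow> id\<^sub>m Y \<cdot> f = f"
  "\<lbrakk>f \<in> ar C; Dom C f = X\<rbrakk> \<Longrightarrow> f \<cdot> id\<^sub>m X = f"
  using ident_left ident_right by (auto simp: Hom_def)

lemma cmp_assoc' [simp]:
  "\<lbrakk>f \<in> ar C; g \<in> ar C; h \<in> ar C; Cod C f = Dom C g; Cod C g = Dom C h\<rbrakk> \<Longrightarrow>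
    (h \<cdot> g) \<cdot> f = h \<cdot> g \<cdot> f"
  by (rule cmp_assoc) (auto simp: Hom_def)

text \<open>Since \<open>cmp_assoc'\<close> nests every composite to the right, a rule for
  \<open>g \<cdot> f\<close> does not match inside a longer chain. This form adds a tail
  \<open>x\<close>.\<close>

lemma cmp_reduce:
  assumes "g \<cdot> f = k" "f \<in> ar C" "g \<in> ar C" "Cod C f = Dom C g" "x \<in> ar C" "Cod C x = Dom C f"
  shows "g \<cdot> f \<cdot> x = k \<cdot> x"
  using assms cmp_assoc' by metis

text \<open>\<open>inv_ar\<close> is a definite description, so uniqueness of two-sided inverses has
  to come before any of its properties.\<close>

lemma inv_ar:
  assumes "is_isomorphism C f"
  shows "inv_ar C f \<in> ar C" "Dom C (inv_ar C f) = Cod C f" "Cod C (inv_ar C f) = Dom C f"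
    "inv_ar C f \<cdot> f = id\<^sub>m (Dom C f)" "f \<cdot> inv_ar C f = id\<^sub>m (Cod C f)"
proof -
  obtain g where f: "f \<in> ar C" and g: "inverse_ar C f g"
    using assms by (auto simp: is_isomorphism_def)
  have "h = g" if h: "inverse_ar C f h" for h
  proof -
    have "h = h \<cdot> (f \<cdot> g)"
      using f g h by (auto simp: inverse_ar_def Hom_def)
    also have "\<dots> = (h \<cdot> f) \<cdot> g"
      using f g h by (subst cmp_assoc') (auto simp: inverse_ar_def Hom_def)
    also have "\<dots> = g"
      using f g h by (auto simp: inverse_ar_def Hom_def)
    finally show ?thesis .
  qed
  hence "inverse_ar C f (inv_ar C f)"
    unfolding inv_ar_def using g by (rule theI[of "inverse_ar C f", rotated])
  thus "inv_ar C f \<in> ar C" "Dom C (inv_ar C f) = Cod C f" "Cod C (inv_ar C f) = Dom C f"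
    "inv_ar C f \<cdot> f = id\<^sub>m (Dom C f)" "f \<cdot> inv_ar C f = id\<^sub>m (Cod C f)"
    by (auto simp: inverse_ar_def Hom_def)
qed

section \<open>Cancelling split and invertible arrows\<close>

lemma section_cancel:
  assumes "e \<cdot> s = id\<^sub>m (Dom C f)" "f \<cdot> e = g \<cdot> e"
    "e \<in> ar C" "s \<in> ar C" "f \<in> ar C" "g \<in> ar C"
    "Cod C e = Dom C f" "Dom C g = Dom C f" "Cod C s = Dom C e"
  shows "f = g"
proof -
  have "f = f \<cdot> e \<cdot> s" using assms by simp
  also have "\<dots> = (f \<cdot> e) \<cdot> s" using assms by (subst cmp_assoc') auto
  also have "\<dots> = g \<cdot> e \<cdot> s" using assms using assms by simp
  also have "\<dots> = g" using assms by simp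
  finally show ?thesis .
qed

lemma retraction_cancel:
  assumes "s \<cdot> m = id\<^sub>m (Cod C f)" "m \<cdot> f = m \<cdot> g"
    "m \<in> ar C" "s \<in> ar C" "f \<in> ar C" "g \<in> ar C"
    "Cod C f = Dom C m" "Cod C g = Dom C m" "Dom C s = Cod C m"
  shows "f = g"
proof -
  have "f = (s \<cdot> m) \<cdot> f" using assms by simp
  also have "\<dots> = s \<cdot> m \<cdot> g" using assms by (subst cmp_assoc') auto
  also have "\<dots> = (s \<cdot> m) \<cdot> g" using assms by (subst cmp_assoc') auto
  also have "\<dots> = g" using assms by simp
  finally show ?thesis .
qed

lemma iso_cancel_right:
  assumes "is_isomorphism C e" "f \<cdot> e = g \<cdot> e" "f \<in> ar C" "g \<in> ar C"
    "Cod C e = Dom C f" "Dom C g = Dom C f"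
  shows "f = g"
proof (rule section_cancel[of e "inv_ar C e"])
  show "e \<in> ar C" using assms(1) by (simp add: is_isomorphism_def)
qed (use assms inv_ar[OF assms(1)] in auto)

lemma iso_cancel_left:
  assumes "is_isomorphism C m" "m \<cdot> f = m \<cdot> g" "f \<in> ar C" "g \<in> ar C"
    "Cod C f = Dom C m" "Cod C g = Dom C m"
  shows "f = g"
proof (rule retraction_cancel[of "inv_ar C m" m])
  show "m \<in> ar C" using assms(1) by (simp add: is_isomorphism_def)
qed (use assms inv_ar[OF assms(1)] in auto)

lemma isoI:
  assumes "f \<in> ar C" "g \<in> ar C" "Dom C g = Cod C f" "Cod C g = Dom C f"
    "g \<cdot> f = id\<^sub>m (Dom C f)" "f \<cdot> g = id\<^sub>m (Cod C f)"
  shows "is_isomorphism C f"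
  unfolding is_isomorphism_def inverse_ar_def using assms by (auto simp: Hom_def)

lemma iso_cmp:
  assumes "is_isomorphism C f" "is_isomorphism C g" "Cod C f = Dom C g"
  shows "is_isomorphism C (g \<cdot> f)"
proof -
  have *: "f \<in> ar C" "g \<in> ar C" using assms by (auto simp: is_isomorphism_def)
  note f = inv_ar[OF assms(1)] and g = inv_ar[OF assms(2)]
  show ?thesis
    by (rule isoI[of _ "inv_ar C f \<cdot> inv_ar C g"])
      (use * f g assms(3) cmp_reduce[OF f(5)] cmp_reduce[OF g(4)] in auto)
qed

end

section \<open>Coherence in symmetric monoidal categories\<close>

context additive_symmetric_monoidal_category
begin

lemma unit_ob' [simp]: "\<I> \<in> ob C"
  by (rule unit_ob)

lemma tensor_ob' [simp]: "\<lbrakk>X \<in> ob C; Y \<in> ob C\<rbrakk> \<Longrightarrow> X \<otimes>\<^sub>o Y \<in> ob C"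
  by (rule tensor_ob)

lemma tensor_ar' [simp]:
  assumes "f \<in> ar C" "g \<in> ar C"
  shows "f \<otimes>\<^sub>m g \<in> ar C" "Dom C (f \<otimes>\<^sub>m g) = Dom C f \<otimes>\<^sub>o Dom C g"
    "Cod C (f \<otimes>\<^sub>m g) = Cod C f \<otimes>\<^sub>o Cod C g"
  using HomD[OF tensor_ar[of f "Dom C f" "Cod C f" g "Dom C g" "Cod C g"]] assms
  by (auto simp: Hom_def)

lemma tensor_ident' [simp]: "\<lbrakk>X \<in> ob C; Y \<in> ob C\<rbrakk> \<Longrightarrow> id\<^sub>m X \<otimes>\<^sub>m id\<^sub>m Y = id\<^sub>m (X \<otimes>\<^sub>o Y)"
  by (rule tensor_ident)

lemma interchange:
  "\<lbrakk>f \<in> ar C; f' \<in> ar C; g \<in> ar C; g' \<in> ar C; Cod C f = Dom C f'; Cod C g = Dom C g'\<rbrakk> \<Longrightarrow>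
    (f' \<otimes>\<^sub>m g') \<cdot> (f \<otimes>\<^sub>m g) = (f' \<cdot> f) \<otimes>\<^sub>m (g' \<cdot> g)"
  by (rule tensor_cmp[symmetric]) (auto simp: Hom_def)

lemma whisker_left:
  "\<lbrakk>A \<in> ob C; f \<in> ar C; g \<in> ar C; Cod C f = Dom C g\<rbrakk> \<Longrightarrow>
    id\<^sub>m A \<otimes>\<^sub>m (g \<cdot> f) = (id\<^sub>m A \<otimes>\<^sub>m g) \<cdot> (id\<^sub>m A \<otimes>\<^sub>m f)"
  by (simp add: interchange)

lemma whisker_right:
  "\<lbrakk>A \<in> ob C; f \<in> ar C; g \<in> ar C; Cod C f = Dom C g\<rbrakk> \<Longrightarrow>
    (g \<cdot> f) \<otimes>\<^sub>m id\<^sub>m A = (g \<otimes>\<^sub>m id\<^sub>m A) \<cdot> (f \<otimes>\<^sub>m id\<^sub>m A)"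
  by (simp add: interchange)

lemma assoc_ar [simp]:
  assumes "X \<in> ob C" "Y \<in> ob C" "Z \<in> ob C"
  shows "associator C X Y Z \<in> ar C" "Dom C (associator C X Y Z) = (X \<otimes>\<^sub>o Y) \<otimes>\<^sub>o Z"
    "Cod C (associator C X Y Z) = X \<otimes>\<^sub>o Y \<otimes>\<^sub>o Z"
  using HomD[OF assoc_Hom[OF assms]] by auto

lemma lunit_ar [simp]:
  assumes "X \<in> ob C"
  shows "left_unitor C X \<in> ar C" "Dom C (left_unitor C X) = \<I> \<otimes>\<^sub>o X" "Cod C (left_unitor C X) = X"
  using HomD[OF lunit_Hom[OF assms]] by auto

lemma runit_ar [simp]:
  assumes "X \<in> ob C"
  shows "right_unitor C X \<in> ar C" "Dom C (right_unitor C X) = X \<otimes>\<^sub>o \<I>" "Cod C (right_unitor C X) = X"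
  using HomD[OF runit_Hom[OF assms]] by auto

lemma braid_ar [simp]:
  assumes "X \<in> ob C" "Y \<in> ob C"
  shows "braiding C X Y \<in> ar C" "Dom C (braiding C X Y) = X \<otimes>\<^sub>o Y" "Cod C (braiding C X Y) = Y \<otimes>\<^sub>o X"
  using HomD[OF braid_Hom[OF assms]] by auto

lemma inv_assoc [simp]:
  assumes "X \<in> ob C" "Y \<in> ob C" "Z \<in> ob C"
  shows "inv_ar C (associator C X Y Z) \<in> ar C"
    "Cod C (inv_ar C (associator C X Y Z)) = (X \<otimes>\<^sub>o Y) \<otimes>\<^sub>o Z"
    "Dom C (inv_ar C (associator C X Y Z)) = X \<otimes>\<^sub>o Y \<otimes>\<^sub>o Z"
    "inv_ar C (associator C X Y Z) \<cdot> associator C X Y Z = id\<^sub>m ((X \<otimes>\<^sub>o Y) \<otimes>\<^sub>o Z)"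
    "associator C X Y Z \<cdot> inv_ar C (associator C X Y Z) = id\<^sub>m (X \<otimes>\<^sub>o Y \<otimes>\<^sub>o Z)"
  using inv_ar[OF assoc_iso[OF assms]] assms by auto

lemma inv_runit [simp]:
  assumes "X \<in> ob C"
  shows "inv_ar C (right_unitor C X) \<in> ar C" "Cod C (inv_ar C (right_unitor C X)) = X \<otimes>\<^sub>o \<I>"
    "Dom C (inv_ar C (right_unitor C X)) = X"
    "inv_ar C (right_unitor C X) \<cdot> right_unitor C X = id\<^sub>m (X \<otimes>\<^sub>o \<I>)"
    "right_unitor C X \<cdot> inv_ar C (right_unitor C X) = id\<^sub>m X"
  using inv_ar[OF runit_iso[OF assms]] assms by auto

lemma assoc_natural':
  "\<lbrakk>f \<in> ar C; g \<in> ar C; h \<in> ar C; Cod C f = X'; Cod C g = Y'; Cod C h = Z'\<rbrakk> \<Longrightarrow>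
    associator C X' Y' Z' \<cdot> ((f \<otimes>\<^sub>m g) \<otimes>\<^sub>m h) =
    (f \<otimes>\<^sub>m g \<otimes>\<^sub>m h) \<cdot> associator C (Dom C f) (Dom C g) (Dom C h)"
  by (rule assoc_natural) (auto simp: Hom_def)

lemma braid_natural':
  "\<lbrakk>f \<in> ar C; g \<in> ar C; Cod C f = X'; Cod C g = Y'\<rbrakk> \<Longrightarrow>
    braiding C X' Y' \<cdot> (f \<otimes>\<^sub>m g) = (g \<otimes>\<^sub>m f) \<cdot> braiding C (Dom C f) (Dom C g)"
  by (rule braid_natural) (auto simp: Hom_def)

lemma lunit_natural':
  "\<lbrakk>f \<in> ar C; Cod C f = X'\<rbrakk> \<Longrightarrow>
    left_unitor C X' \<cdot> (id\<^sub>m \<I> \<otimes>\<^sub>m f) = f \<cdot> left_unitor C (Dom C f)"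
  by (rule lunit_natural) (auto simp: Hom_def)

lemma runit_natural':
  "\<lbrakk>f \<in> ar C; Cod C f = X'\<rbrakk> \<Longrightarrow>
    right_unitor C X' \<cdot> (f \<otimes>\<^sub>m id\<^sub>m \<I>) = f \<cdot> right_unitor C (Dom C f)"
  by (rule runit_natural) (auto simp: Hom_def)

lemma inv_assoc_natural:
  assumes [simp]: "f \<in> ar C" "g \<in> ar C" "h \<in> ar C" "Cod C f = X'" "Cod C g = Y'" "Cod C h = Z'"
  shows "inv_ar C (associator C X' Y' Z') \<cdot> (f \<otimes>\<^sub>m g \<otimes>\<^sub>m h) =
    ((f \<otimes>\<^sub>m g) \<otimes>\<^sub>m h) \<cdot> inv_ar C (associator C (Dom C f) (Dom C g) (Dom C h))"
proof -
  have [simp]: "X' \<in> ob C" "Y' \<in> ob C" "Z' \<in> ob C"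
    using assms ob_Dom_Cod(2) by blast+
  show ?thesis
    by (rule iso_cancel_left[OF assoc_iso[of X' Y' Z']])
      (simp_all add: cmp_reduce[OF inv_assoc(5)] cmp_reduce[OF assoc_natural'])
qed

lemma iso_whisker_right:
  assumes "is_isomorphism C f" "A \<in> ob C"
  shows "is_isomorphism C (f \<otimes>\<^sub>m id\<^sub>m A)"
proof -
  have [simp]: "f \<in> ar C" using assms by (simp add: is_isomorphism_def)
  show ?thesis using assms inv_ar[OF assms(1)]
    by (intro isoI[of _ "inv_ar C f \<otimes>\<^sub>m id\<^sub>m A"]) (simp_all add: interchange)
qed

lemma iso_whisker_left:
  assumes "is_isomorphism C f" "A \<in> ob C"
  shows "is_isomorphism C (id\<^sub>m A \<otimes>\<^sub>m f)"
proof -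
  have [simp]: "f \<in> ar C" using assms by (simp add: is_isomorphism_def)
  show ?thesis using assms inv_ar[OF assms(1)]
    by (intro isoI[of _ "id\<^sub>m A \<otimes>\<^sub>m inv_ar C f"]) (simp_all add: interchange)
qed

text \<open>By naturality of the left unitor, which is invertible,
  \<open>id\<^sub>m \<I> \<otimes>\<^sub>m f\<close> determines \<open>f\<close>.\<close>

lemma unit_whisker_left_cancel:
  assumes [simp]: "f \<in> ar C" "g \<in> ar C" "Dom C f = Dom C g" "Cod C f = Cod C g"
    and eq: "id\<^sub>m \<I> \<otimes>\<^sub>m f = id\<^sub>m \<I> \<otimes>\<^sub>m g"
  shows "f = g"
proof (rule iso_cancel_right[OF lunit_iso[of "Dom C g"]])
  show "f \<cdot> left_unitor C (Dom C g) = g \<cdot> left_unitor C (Dom C g)"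
    using lunit_natural'[of f "Cod C g"] lunit_natural'[of g "Cod C g"] eq by simp
qed auto

lemma unit_whisker_right_cancel:
  assumes [simp]: "f \<in> ar C" "g \<in> ar C" "Dom C f = Dom C g" "Cod C f = Cod C g"
    and eq: "f \<otimes>\<^sub>m id\<^sub>m \<I> = g \<otimes>\<^sub>m id\<^sub>m \<I>"
  shows "f = g"
proof (rule iso_cancel_right[OF runit_iso[of "Dom C g"]])
  show "f \<cdot> right_unitor C (Dom C g) = g \<cdot> right_unitor C (Dom C g)"
    using runit_natural'[of f "Cod C g"] runit_natural'[of g "Cod C g"] eq by simp
qed auto

text \<open>
  Kelly's argument: after tensoring with \<open>\<I>\<close> on the left, the pentagon reduces the claim to \<open>triangle\<close>.
\<close>

lemma lunit_tensor:
  assumes [simp]: "X \<in> ob C" "Y \<in> ob C"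
  shows "left_unitor C (X \<otimes>\<^sub>o Y) \<cdot> associator C \<I> X Y = left_unitor C X \<otimes>\<^sub>m id\<^sub>m Y"
    (is "?l = ?r")
proof -
  let ?e = "associator C \<I> (\<I> \<otimes>\<^sub>o X) Y \<cdot> (associator C \<I> \<I> X \<otimes>\<^sub>m id\<^sub>m Y)"
  have "(id\<^sub>m \<I> \<otimes>\<^sub>m ?l) \<cdot> ?e =
      (id\<^sub>m \<I> \<otimes>\<^sub>m left_unitor C (X \<otimes>\<^sub>o Y)) \<cdot> associator C \<I> \<I> (X \<otimes>\<^sub>o Y) \<cdot> associator C (\<I> \<otimes>\<^sub>o \<I>) X Y"
    by (simp add: whisker_left pentagon)
  also have "\<dots> = (right_unitor C \<I> \<otimes>\<^sub>m id\<^sub>m (X \<otimes>\<^sub>o Y)) \<cdot> associator C (\<I> \<otimes>\<^sub>o \<I>) X Y"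
    by (simp add: cmp_reduce[OF triangle])
  also have "\<dots> = associator C \<I> X Y \<cdot> ((right_unitor C \<I> \<otimes>\<^sub>m id\<^sub>m X) \<otimes>\<^sub>m id\<^sub>m Y)"
    by (simp add: assoc_natural')
  also have "\<dots> = (id\<^sub>m \<I> \<otimes>\<^sub>m ?r) \<cdot> ?e"
    by (simp add: triangle[symmetric] whisker_right cmp_reduce[OF assoc_natural'])
  finally have *: "(id\<^sub>m \<I> \<otimes>\<^sub>m ?l) \<cdot> ?e = (id\<^sub>m \<I> \<otimes>\<^sub>m ?r) \<cdot> ?e" .
  have "is_isomorphism C ?e"
    by (simp add: iso_cmp assoc_iso iso_whisker_right)
  from iso_cancel_right[OF this *] show ?thesis
    by (rule unit_whisker_left_cancel[rotated 4]) auto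
qed

text \<open>After tensoring with \<open>\<I>\<close> on the right, this follows from the hexagon for
  \<open>X\<close>, \<open>\<I>\<close>, \<open>\<I>\<close>: \<open>lunit_tensor\<close>,
  naturality and the symmetry of the braiding reduce it to \<open>triangle\<close>.\<close>

lemma lunit_braid:
  assumes [simp]: "X \<in> ob C"
  shows "left_unitor C X \<cdot> braiding C X \<I> = right_unitor C X"
proof (rule unit_whisker_right_cancel)
  have "(left_unitor C X \<otimes>\<^sub>m id\<^sub>m \<I>) \<cdot> (braiding C X \<I> \<otimes>\<^sub>m id\<^sub>m \<I>) =
      left_unitor C (X \<otimes>\<^sub>o \<I>) \<cdot> associator C \<I> X \<I> \<cdot> (braiding C X \<I> \<otimes>\<^sub>m id\<^sub>m \<I>)"
    by (simp add: lunit_tensor[symmetric])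
  \<comment> \<open>An identity is inserted as a double braiding, one half of which completes the
    right-hand side of the hexagon.\<close>
  also have "\<dots> = left_unitor C (X \<otimes>\<^sub>o \<I>) \<cdot> (id\<^sub>m \<I> \<otimes>\<^sub>m (braiding C \<I> X \<cdot> braiding C X \<I>)) \<cdot>
      associator C \<I> X \<I> \<cdot> (braiding C X \<I> \<otimes>\<^sub>m id\<^sub>m \<I>)"
    by (simp add: braid_symmetric)
  also have "\<dots> = left_unitor C (X \<otimes>\<^sub>o \<I>) \<cdot> (id\<^sub>m \<I> \<otimes>\<^sub>m braiding C \<I> X) \<cdot>
      associator C \<I> \<I> X \<cdot> braiding C X (\<I> \<otimes>\<^sub>o \<I>) \<cdot> associator C X \<I> \<I>"
    by (simp add: hexagon whisker_left)
  also have "\<dots> = braiding C \<I> X \<cdot> (left_unitor C \<I> \<otimes>\<^sub>m id\<^sub>m X) \<cdot>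
      braiding C X (\<I> \<otimes>\<^sub>o \<I>) \<cdot> associator C X \<I> \<I>"
    by (simp add: cmp_reduce[OF lunit_natural'] cmp_reduce[OF lunit_tensor])
  also have "\<dots> = braiding C \<I> X \<cdot> braiding C X \<I> \<cdot> (id\<^sub>m X \<otimes>\<^sub>m left_unitor C \<I>) \<cdot> associator C X \<I> \<I>"
    by (simp add: cmp_reduce[OF braid_natural'])
  also have "\<dots> = right_unitor C X \<otimes>\<^sub>m id\<^sub>m \<I>"
    by (simp add: cmp_reduce[OF braid_symmetric] triangle)
  finally show "(left_unitor C X \<cdot> braiding C X \<I>) \<otimes>\<^sub>m id\<^sub>m \<I> = right_unitor C X \<otimes>\<^sub>m id\<^sub>m \<I>"
    by (simp add: whisker_right)
qed auto

section \<open>The symmetry exchanging the two outer factors\<close>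

lemma swap_ar [simp]:
  assumes "A \<in> ob C" "B \<in> ob C" "X \<in> ob C"
  shows "swap_left C A B X \<in> ar C" "Dom C (swap_left C A B X) = A \<otimes>\<^sub>o B \<otimes>\<^sub>o X"
    "Cod C (swap_left C A B X) = B \<otimes>\<^sub>o A \<otimes>\<^sub>o X"
  using assms by (simp_all add: swap_left_def)

text \<open>Precomposing with an associator removes the inverse inside
  \<open>swap_left\<close>.\<close>

lemma swap_assoc:
  assumes [simp]: "A \<in> ob C" "B \<in> ob C" "X \<in> ob C"
  shows "swap_left C A B X \<cdot> associator C A B X = associator C B A X \<cdot> (braiding C A B \<otimes>\<^sub>m id\<^sub>m X)"
  by (simp add: swap_left_def)

lemma swap_natural:
  assumes [simp]: "f \<in> ar C" "g \<in> ar C" "h \<in> ar C" "Cod C f = A'" "Cod C g = B'" "Cod C h = X'"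
  shows "swap_left C A' B' X' \<cdot> (f \<otimes>\<^sub>m g \<otimes>\<^sub>m h) =
    (g \<otimes>\<^sub>m f \<otimes>\<^sub>m h) \<cdot> swap_left C (Dom C f) (Dom C g) (Dom C h)"
proof -
  have [simp]: "A' \<in> ob C" "B' \<in> ob C" "X' \<in> ob C"
    using assms ob_Dom_Cod(2) by blast+
  have *: "(braiding C A' B' \<otimes>\<^sub>m id\<^sub>m X') \<cdot> ((f \<otimes>\<^sub>m g) \<otimes>\<^sub>m h) =
      ((g \<otimes>\<^sub>m f) \<otimes>\<^sub>m h) \<cdot> (braiding C (Dom C f) (Dom C g) \<otimes>\<^sub>m id\<^sub>m (Dom C h))"
    by (simp add: interchange braid_natural')
  show ?thesis
    by (simp add: swap_left_def inv_assoc_natural cmp_reduce[OF *] cmp_reduce[OF assoc_natural'])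
qed

lemma swap_swap:
  assumes [simp]: "A \<in> ob C" "B \<in> ob C" "X \<in> ob C"
  shows "swap_left C B A X \<cdot> swap_left C A B X = id\<^sub>m (A \<otimes>\<^sub>o B \<otimes>\<^sub>o X)"
proof -
  have *: "(braiding C B A \<otimes>\<^sub>m id\<^sub>m X) \<cdot> (braiding C A B \<otimes>\<^sub>m id\<^sub>m X) = id\<^sub>m ((A \<otimes>\<^sub>o B) \<otimes>\<^sub>o X)"
    by (simp add: interchange braid_symmetric)
  show ?thesis
    by (simp add: swap_left_def cmp_reduce[OF inv_assoc(4)] cmp_reduce[OF *])
qed

text \<open>This is the hexagon tensored with \<open>X\<close>: moving \<open>A\<close> past
  \<open>B \<otimes> D\<close> means moving it past \<open>B\<close>, then past \<open>D\<close>.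
  Pentagons account for the brackets.\<close>

lemma swap_tensor:
  assumes [simp]: "A \<in> ob C" "B \<in> ob C" "D \<in> ob C" "X \<in> ob C"
  shows "associator C B D (A \<otimes>\<^sub>o X) \<cdot> swap_left C A (B \<otimes>\<^sub>o D) X =
    (id\<^sub>m B \<otimes>\<^sub>m swap_left C A D X) \<cdot> swap_left C A B (D \<otimes>\<^sub>o X) \<cdot> (id\<^sub>m A \<otimes>\<^sub>m associator C B D X)"
    (is "?l = ?r")
proof -
  \<comment> \<open>This isomorphism supplies the associators that \<open>swap_assoc\<close>
    consumes, on the right-hand side after a use of the pentagon.\<close>
  let ?e = "associator C A (B \<otimes>\<^sub>o D) X \<cdot> (associator C A B D \<otimes>\<^sub>m id\<^sub>m X)"
  have hex: "(associator C B D A \<otimes>\<^sub>m id\<^sub>m X) \<cdot> (braiding C A (B \<otimes>\<^sub>o D) \<otimes>\<^sub>m id\<^sub>m X) \<cdot>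
      (associator C A B D \<otimes>\<^sub>m id\<^sub>m X) =
      ((id\<^sub>m B \<otimes>\<^sub>m braiding C A D) \<otimes>\<^sub>m id\<^sub>m X) \<cdot> (associator C B A D \<otimes>\<^sub>m id\<^sub>m X) \<cdot>
      ((braiding C A B \<otimes>\<^sub>m id\<^sub>m D) \<otimes>\<^sub>m id\<^sub>m X)"
    by (simp add: whisker_right[symmetric] hexagon)
  have nat: "associator C B A (D \<otimes>\<^sub>o X) \<cdot> (braiding C A B \<otimes>\<^sub>m id\<^sub>m (D \<otimes>\<^sub>o X)) \<cdot> associator C (A \<otimes>\<^sub>o B) D X =
      associator C B A (D \<otimes>\<^sub>o X) \<cdot> associator C (B \<otimes>\<^sub>o A) D X \<cdot> ((braiding C A B \<otimes>\<^sub>m id\<^sub>m D) \<otimes>\<^sub>m id\<^sub>m X)"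
    by (simp add: assoc_natural')
  have "?l \<cdot> ?e = associator C B D (A \<otimes>\<^sub>o X) \<cdot> associator C (B \<otimes>\<^sub>o D) A X \<cdot>
      (braiding C A (B \<otimes>\<^sub>o D) \<otimes>\<^sub>m id\<^sub>m X) \<cdot> (associator C A B D \<otimes>\<^sub>m id\<^sub>m X)"
    by (simp add: cmp_reduce[OF swap_assoc])
  also have "\<dots> = (id\<^sub>m B \<otimes>\<^sub>m associator C D A X) \<cdot> associator C B (D \<otimes>\<^sub>o A) X \<cdot>
      ((id\<^sub>m B \<otimes>\<^sub>m braiding C A D) \<otimes>\<^sub>m id\<^sub>m X) \<cdot> (associator C B A D \<otimes>\<^sub>m id\<^sub>m X) \<cdot>
      ((braiding C A B \<otimes>\<^sub>m id\<^sub>m D) \<otimes>\<^sub>m id\<^sub>m X)"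
    by (simp add: cmp_reduce[OF pentagon] hex)
  also have "\<dots> = (id\<^sub>m B \<otimes>\<^sub>m (associator C D A X \<cdot> (braiding C A D \<otimes>\<^sub>m id\<^sub>m X))) \<cdot> associator C B (A \<otimes>\<^sub>o D) X \<cdot>
      (associator C B A D \<otimes>\<^sub>m id\<^sub>m X) \<cdot> ((braiding C A B \<otimes>\<^sub>m id\<^sub>m D) \<otimes>\<^sub>m id\<^sub>m X)"
    by (simp add: cmp_reduce[OF assoc_natural'] whisker_left)
  also have "\<dots> = (id\<^sub>m B \<otimes>\<^sub>m swap_left C A D X) \<cdot> (id\<^sub>m B \<otimes>\<^sub>m associator C A D X) \<cdot> associator C B (A \<otimes>\<^sub>o D) X \<cdot>
      (associator C B A D \<otimes>\<^sub>m id\<^sub>m X) \<cdot> ((braiding C A B \<otimes>\<^sub>m id\<^sub>m D) \<otimes>\<^sub>m id\<^sub>m X)"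
    by (simp add: swap_assoc[symmetric] whisker_left)
  also have "\<dots> = (id\<^sub>m B \<otimes>\<^sub>m swap_left C A D X) \<cdot> associator C B A (D \<otimes>\<^sub>o X) \<cdot>
      (braiding C A B \<otimes>\<^sub>m id\<^sub>m (D \<otimes>\<^sub>o X)) \<cdot> associator C (A \<otimes>\<^sub>o B) D X"
    by (simp only: nat) (simp add: cmp_reduce[OF pentagon])
  also have "\<dots> = ?r \<cdot> ?e"
    by (simp add: pentagon[symmetric] cmp_reduce[OF swap_assoc])
  finally have *: "?l \<cdot> ?e = ?r \<cdot> ?e" .
  have "is_isomorphism C ?e"
    by (simp add: iso_cmp assoc_iso iso_whisker_right)
  from iso_cancel_right[OF this *] show ?thesis
    by auto
qed


section \<open>Iterated suspensions\<close>

text \<open>The factors are nested directly around \<open>X\<close>: a set that contains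
  \<open>X\<close> and is closed under \<open>A \<otimes> (-)\<close> then contains every
  \<open>susp_ob A n X\<close>, even if it is not closed under isomorphism.\<close>

primrec susp_ob :: "'o \<Rightarrow> nat \<Rightarrow> 'o \<Rightarrow> 'o"
  where
    "susp_ob A 0 X = X"
  | "susp_ob A (Suc n) X = A \<otimes>\<^sub>o susp_ob A n X"

primrec susp_ar :: "'o \<Rightarrow> nat \<Rightarrow> 'm \<Rightarrow> 'm"
  where
    "susp_ar A 0 f = f"
  | "susp_ar A (Suc n) f = id\<^sub>m A \<otimes>\<^sub>m susp_ar A n f"

primrec susp_map :: "'m \<Rightarrow> nat \<Rightarrow> 'o \<Rightarrow> 'm"
  where
    "susp_map j 0 X = id\<^sub>m X"
  | "susp_map j (Suc n) X = j \<otimes>\<^sub>m susp_map j n X"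

text \<open>Moves the first of \<open>n + 1\<close> factors \<open>A\<close> to the last place, without tensor powers of \<open>A\<close>.\<close>

primrec cycle :: "'o \<Rightarrow> nat \<Rightarrow> 'o \<Rightarrow> 'm"
  where
    "cycle A 0 X = id\<^sub>m (A \<otimes>\<^sub>o X)"
  | "cycle A (Suc n) X = (id\<^sub>m A \<otimes>\<^sub>m cycle A n X) \<cdot> swap_left C A A (susp_ob A n X)"

text \<open>The swaps of \<open>cycle\<close> in the opposite order; they return the last factor to
  the first place.\<close>

primrec cycle_back :: "'o \<Rightarrow> nat \<Rightarrow> 'o \<Rightarrow> 'm"
  where
    "cycle_back A 0 X = id\<^sub>m (A \<otimes>\<^sub>o X)"
  | "cycle_back A (Suc n) X = swap_left C A A (susp_ob A n X) \<cdot> (id\<^sub>m A \<otimes>\<^sub>m cycle_back A n X)"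

text \<open>The coherence isomorphism from the bracketing of \<open>tensor_power\<close> to that of
  \<open>susp_ob\<close>; it permutes nothing.\<close>

primrec unpack :: "'o \<Rightarrow> nat \<Rightarrow> 'o \<Rightarrow> 'm"
  where
    "unpack A 0 X = left_unitor C X"
  | "unpack A (Suc n) X = (id\<^sub>m A \<otimes>\<^sub>m unpack A n X) \<cdot> associator C A (tensor_power C A n) X"

lemma susp_ob [simp]: "\<lbrakk>A \<in> ob C; X \<in> ob C\<rbrakk> \<Longrightarrow> susp_ob A n X \<in> ob C"
  by (induction n) auto

text \<open>An equality of objects, not only an isomorphism: both sides nest \<open>n + 1\<close>
  factors \<open>A\<close> around \<open>X\<close>. Inner and outer factors can be traded without
  coherence maps.\<close>

lemma susp_ob_shift [simp]: "susp_ob A n (A \<otimes>\<^sub>o X) = A \<otimes>\<^sub>o susp_ob A n X"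
  by (induction n) auto

lemma susp_ar [simp]:
  assumes [simp]: "A \<in> ob C" "f \<in> ar C"
  shows "susp_ar A n f \<in> ar C" "Dom C (susp_ar A n f) = susp_ob A n (Dom C f)"
    "Cod C (susp_ar A n f) = susp_ob A n (Cod C f)"
  by (induction n) auto

lemma susp_ar_shift: "susp_ar A n (id\<^sub>m A \<otimes>\<^sub>m f) = id\<^sub>m A \<otimes>\<^sub>m susp_ar A n f"
  by (induction n) auto

lemma susp_map [simp]:
  assumes [simp]: "j \<in> ar C" "X \<in> ob C"
  shows "susp_map j n X \<in> ar C" "Dom C (susp_map j n X) = susp_ob (Dom C j) n X"
    "Cod C (susp_map j n X) = susp_ob (Cod C j) n X"
  by (induction n) auto

lemma susp_map_natural:
  assumes [simp]: "j \<in> ar C" "f \<in> ar C"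
  shows "susp_map j n (Cod C f) \<cdot> susp_ar (Dom C j) n f = susp_ar (Cod C j) n f \<cdot> susp_map j n (Dom C f)"
  by (induction n) (auto simp: interchange)

text \<open>Makes \<open>susp_map j n X\<close> a split monomorphism, so that equations can be
  tested after passing from factors \<open>Dom C j\<close> to factors
  \<open>Cod C j\<close>.\<close>

lemma susp_map_retraction:
  assumes [simp]: "j \<in> ar C" "q \<in> ar C" "Cod C j = Dom C q" "q \<cdot> j = id\<^sub>m (Dom C j)" "X \<in> ob C"
  shows "susp_map q n X \<cdot> susp_map j n X = id\<^sub>m (susp_ob (Dom C j) n X)"
  by (induction n) (auto simp: interchange)

lemma cycle [simp]:
  assumes [simp]: "A \<in> ob C" "X \<in> ob C"
  shows "cycle A n X \<in> ar C" "Dom C (cycle A n X) = A \<otimes>\<^sub>o susp_ob A n X"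
    "Cod C (cycle A n X) = A \<otimes>\<^sub>o susp_ob A n X"
  by (induction n) auto

lemma cycle_back [simp]:
  assumes [simp]: "A \<in> ob C" "X \<in> ob C"
  shows "cycle_back A n X \<in> ar C" "Dom C (cycle_back A n X) = A \<otimes>\<^sub>o susp_ob A n X"
    "Cod C (cycle_back A n X) = A \<otimes>\<^sub>o susp_ob A n X"
  by (induction n) auto

lemma cycle_back_cycle:
  assumes [simp]: "A \<in> ob C" "X \<in> ob C"
  shows "cycle_back A n X \<cdot> cycle A n X = id\<^sub>m (A \<otimes>\<^sub>o susp_ob A n X)"
proof (induction n)
  case (Suc n)
  have *: "(id\<^sub>m A \<otimes>\<^sub>m cycle_back A n X) \<cdot> (id\<^sub>m A \<otimes>\<^sub>m cycle A n X) = id\<^sub>m (A \<otimes>\<^sub>o A \<otimes>\<^sub>o susp_ob A n X)"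
    by (simp add: interchange Suc)
  show ?case
    by (simp add: cmp_reduce[OF *] swap_swap)
qed auto

section \<open>Comparison with tensor powers and cyclic permutations\<close>

lemma tensor_power [simp]: "A \<in> ob C \<Longrightarrow> tensor_power C A n \<in> ob C"
  by (induction n) auto

lemma unpack [simp]:
  assumes [simp]: "A \<in> ob C" "X \<in> ob C"
  shows "unpack A n X \<in> ar C" "Dom C (unpack A n X) = tensor_power C A n \<otimes>\<^sub>o X"
    "Cod C (unpack A n X) = susp_ob A n X"
  by (induction n) auto

lemma unpack_iso:
  assumes [simp]: "A \<in> ob C" "X \<in> ob C"
  shows "is_isomorphism C (unpack A n X)"
  by (induction n) (auto intro!: iso_cmp iso_whisker_left simp: lunit_iso assoc_iso)

lemma append_factor [simp]:
  assumes [simp]: "A \<in> ob C"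
  shows "append_factor C A n \<in> ar C" "Dom C (append_factor C A n) = tensor_power C A n \<otimes>\<^sub>o A"
    "Cod C (append_factor C A n) = A \<otimes>\<^sub>o tensor_power C A n"
  by (induction n) auto

text \<open>Neither side permutes factors, so this is pure coherence: the base case rests on
  \<open>triangle\<close> and \<open>lunit_tensor\<close>, the step on
  \<open>pentagon\<close>.\<close>

lemma unpack_append_factor:
  assumes [simp]: "A \<in> ob C" "X \<in> ob C"
  shows "unpack A (Suc n) X \<cdot> (append_factor C A n \<otimes>\<^sub>m id\<^sub>m X) =
    unpack A n (A \<otimes>\<^sub>o X) \<cdot> associator C (tensor_power C A n) A X"
proof (induction n)
  case 0
  have *: "(right_unitor C A \<otimes>\<^sub>m id\<^sub>m X) \<cdot> (inv_ar C (right_unitor C A) \<otimes>\<^sub>m id\<^sub>m X) = id\<^sub>m (A \<otimes>\<^sub>o X)"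
    by (simp add: interchange)
  show ?case
    by (simp add: whisker_right cmp_reduce[OF triangle] cmp_reduce[OF *] lunit_tensor)
next
  case (Suc n)
  let ?P = "tensor_power C A n"
  have "unpack A (Suc (Suc n)) X \<cdot> (append_factor C A (Suc n) \<otimes>\<^sub>m id\<^sub>m X) =
      (id\<^sub>m A \<otimes>\<^sub>m (unpack A (Suc n) X \<cdot> (append_factor C A n \<otimes>\<^sub>m id\<^sub>m X))) \<cdot>
      associator C A (?P \<otimes>\<^sub>o A) X \<cdot> (associator C A ?P A \<otimes>\<^sub>m id\<^sub>m X)"
    by (simp add: whisker_right whisker_left cmp_reduce[OF assoc_natural'])
  also have "\<dots> = (id\<^sub>m A \<otimes>\<^sub>m unpack A n (A \<otimes>\<^sub>o X)) \<cdot> (id\<^sub>m A \<otimes>\<^sub>m associator C ?P A X) \<cdot>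
      associator C A (?P \<otimes>\<^sub>o A) X \<cdot> (associator C A ?P A \<otimes>\<^sub>m id\<^sub>m X)"
    by (simp only: Suc) (simp add: whisker_left)
  also have "\<dots> = unpack A (Suc n) (A \<otimes>\<^sub>o X) \<cdot> associator C (tensor_power C A (Suc n)) A X"
    by (simp add: pentagon)
  finally show ?case .
qed

text \<open>Passing a whole power is passing its factors one by one: \<open>swap_tensor\<close>
  splits off a factor, and by \<open>lunit_braid\<close> passing the unit does nothing.\<close>

lemma unpack_swap:
  assumes [simp]: "A \<in> ob C" "X \<in> ob C"
  shows "unpack A n (A \<otimes>\<^sub>o X) \<cdot> swap_left C A (tensor_power C A n) X =
    cycle A n X \<cdot> (id\<^sub>m A \<otimes>\<^sub>m unpack A n X)"
proof (induction n)
  case 0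
  have *: "(left_unitor C A \<otimes>\<^sub>m id\<^sub>m X) \<cdot> (braiding C A \<I> \<otimes>\<^sub>m id\<^sub>m X) = right_unitor C A \<otimes>\<^sub>m id\<^sub>m X"
    by (simp add: interchange lunit_braid)
  show ?case
    by (simp add: swap_left_def cmp_reduce[OF lunit_tensor] cmp_reduce[OF *] triangle[symmetric])
next
  case (Suc n)
  let ?P = "tensor_power C A n"
  have "unpack A (Suc n) (A \<otimes>\<^sub>o X) \<cdot> swap_left C A (tensor_power C A (Suc n)) X =
      (id\<^sub>m A \<otimes>\<^sub>m (unpack A n (A \<otimes>\<^sub>o X) \<cdot> swap_left C A ?P X)) \<cdot> swap_left C A A (?P \<otimes>\<^sub>o X) \<cdot>
      (id\<^sub>m A \<otimes>\<^sub>m associator C A ?P X)"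
    by (simp add: whisker_left swap_tensor)
  also have "\<dots> = (id\<^sub>m A \<otimes>\<^sub>m cycle A n X) \<cdot> (id\<^sub>m A \<otimes>\<^sub>m id\<^sub>m A \<otimes>\<^sub>m unpack A n X) \<cdot> swap_left C A A (?P \<otimes>\<^sub>o X) \<cdot>
      (id\<^sub>m A \<otimes>\<^sub>m associator C A ?P X)"
    by (simp only: Suc) (simp add: whisker_left)
  also have "\<dots> = cycle A (Suc n) X \<cdot> (id\<^sub>m A \<otimes>\<^sub>m unpack A (Suc n) X)"
    by (simp add: whisker_left cmp_reduce[OF swap_natural] del: tensor_ident')
  finally show ?case .
qed

text \<open>Combines the two preceding lemmas. Cycling \<open>n + 1\<close> factors takes
  \<open>n\<close> swaps, hence the index \<open>n\<close> of \<open>cycle\<close>.\<close>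

lemma unpack_cyclic_perm:
  assumes [simp]: "A \<in> ob C" "X \<in> ob C"
  shows "unpack A (Suc n) X \<cdot> (cyclic_perm C A (Suc n) \<otimes>\<^sub>m id\<^sub>m X) = cycle A n X \<cdot> unpack A (Suc n) X"
proof -
  let ?P = "tensor_power C A n"
  have "unpack A (Suc n) X \<cdot> (cyclic_perm C A (Suc n) \<otimes>\<^sub>m id\<^sub>m X) =
      (unpack A (Suc n) X \<cdot> (append_factor C A n \<otimes>\<^sub>m id\<^sub>m X)) \<cdot> (braiding C A ?P \<otimes>\<^sub>m id\<^sub>m X)"
    by (simp add: whisker_right)
  also have "\<dots> = unpack A n (A \<otimes>\<^sub>o X) \<cdot> swap_left C A ?P X \<cdot> associator C A ?P X"
    by (simp only: unpack_append_factor assms) (simp add: swap_assoc)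
  also have "\<dots> = cycle A n X \<cdot> unpack A (Suc n) X"
    by (simp add: cmp_reduce[OF unpack_swap])
  finally show ?thesis .
qed

lemma cycle_symmetric_object:
  assumes [simp]: "A \<in> ob C" and "symmetric_object C A"
  obtains n where "\<And>X. X \<in> ob C \<Longrightarrow> cycle A (Suc n) X = id\<^sub>m (A \<otimes>\<^sub>o A \<otimes>\<^sub>o susp_ob A n X)"
proof -
  obtain n where "n \<ge> 2" and n: "cyclic_perm C A n = id\<^sub>m (tensor_power C A n)"
    using assms(2) unfolding symmetric_object_def by blast
  \<comment> \<open>Because \<open>n \<ge> 2\<close>, the index \<open>n - 1\<close> of the
    resulting \<open>cycle\<close> is a successor; this leaves one factor that
    \<open>unit_iso\<close> can split off.\<close>
  then obtain m where m: "n = Suc (Suc m)"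
    using le_Suc_ex[of 2 n] by auto
  show ?thesis
  proof (rule that)
    fix X assume [simp]: "X \<in> ob C"
    show "cycle A (Suc m) X = id\<^sub>m (A \<otimes>\<^sub>o A \<otimes>\<^sub>o susp_ob A m X)"
    proof (rule iso_cancel_right[OF unpack_iso[of A X n]])
      show "cycle A (Suc m) X \<cdot> unpack A n X = id\<^sub>m (A \<otimes>\<^sub>o A \<otimes>\<^sub>o susp_ob A m X) \<cdot> unpack A n X"
        using unpack_cyclic_perm[of A X "Suc m"] unfolding m[symmetric] n by (simp add: m)
    qed (simp_all add: m)
  qed
qed

end


section \<open>Adjoints of suspensions\<close>

text \<open>\<open>H\<close> is arbitrary here: the locale serves both for \<open>G\<close> and for
  its complement.\<close>

locale suspension_adjunction = additive_symmetric_monoidal_category C +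
  adjunction C C "Susp C H" \<Omega> \<eta> \<epsilon>
  for C :: "('o, 'm, 'x) tensor_data_scheme" (structure) and H \<Omega> \<eta> \<epsilon> +
  assumes H_ob [simp]: "H \<in> ob C"
begin

lemma Omega_ob [simp]: "X \<in> ob C \<Longrightarrow> on_ob \<Omega> X \<in> ob C"
  by (rule R.on_ob)

lemma Omega_ar [simp]:
  assumes "f \<in> ar C"
  shows "on_ar \<Omega> f \<in> ar C" "Dom C (on_ar \<Omega> f) = on_ob \<Omega> (Dom C f)"
    "Cod C (on_ar \<Omega> f) = on_ob \<Omega> (Cod C f)"
  using HomD[OF R.on_ar[of f "Dom C f" "Cod C f"]] assms by (auto simp: Hom_def)

lemma Omega_cmp:
  "\<lbrakk>f \<in> ar C; g \<in> ar C; Cod C f = Dom C g\<rbrakk> \<Longrightarrow> on_ar \<Omega> (g \<cdot> f) = on_ar \<Omega> g \<cdot> on_ar \<Omega> f"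
  by (rule R.on_cmp) (auto simp: Hom_def)

lemma Omega_ident [simp]: "X \<in> ob C \<Longrightarrow> on_ar \<Omega> (id\<^sub>m X) = id\<^sub>m (on_ob \<Omega> X)"
  by (rule R.on_ident)

lemma unit_ar [simp]:
  assumes "X \<in> ob C"
  shows "\<eta> X \<in> ar C" "Dom C (\<eta> X) = X" "Cod C (\<eta> X) = on_ob \<Omega> (H \<otimes>\<^sub>o X)"
  using HomD[OF unit_Hom[OF assms]] by (auto simp: Susp_def)

lemma counit_ar [simp]:
  assumes "X \<in> ob C"
  shows "\<epsilon> X \<in> ar C" "Dom C (\<epsilon> X) = H \<otimes>\<^sub>o on_ob \<Omega> X" "Cod C (\<epsilon> X) = X"
  using HomD[OF counit_Hom[OF assms]] by (auto simp: Susp_def)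

lemma unit_natural':
  "\<lbrakk>f \<in> ar C; Cod C f = X'\<rbrakk> \<Longrightarrow> \<eta> X' \<cdot> f = on_ar \<Omega> (id\<^sub>m H \<otimes>\<^sub>m f) \<cdot> \<eta> (Dom C f)"
  using unit_natural[of f "Dom C f" X'] by (auto simp: Susp_def Hom_def)

lemma counit_natural':
  "\<lbrakk>f \<in> ar C; Cod C f = X'\<rbrakk> \<Longrightarrow> \<epsilon> X' \<cdot> (id\<^sub>m H \<otimes>\<^sub>m on_ar \<Omega> f) = f \<cdot> \<epsilon> (Dom C f)"
  using counit_natural[of f "Dom C f" X'] by (auto simp: Susp_def Hom_def)

lemma counit_susp_unit: "X \<in> ob C \<Longrightarrow> \<epsilon> (H \<otimes>\<^sub>o X) \<cdot> (id\<^sub>m H \<otimes>\<^sub>m \<eta> X) = id\<^sub>m (H \<otimes>\<^sub>o X)"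
  using triangle_L by (simp add: Susp_def)

lemma Omega_counit_unit: "X \<in> ob C \<Longrightarrow> on_ar \<Omega> (\<epsilon> X) \<cdot> \<eta> (on_ob \<Omega> X) = id\<^sub>m (on_ob \<Omega> X)"
  by (rule triangle_R)

lemma adjunct_ar [simp]:
  assumes "A \<in> ob C" "h \<in> ar C" "Dom C h = H \<otimes>\<^sub>o A"
  shows "adjunct C \<Omega> \<eta> A h \<in> ar C" "Dom C (adjunct C \<Omega> \<eta> A h) = A"
    "Cod C (adjunct C \<Omega> \<eta> A h) = on_ob \<Omega> (Cod C h)"
  using assms by (simp_all add: adjunct_def)

lemma counit_adjunct:
  assumes "A \<in> ob C" "h \<in> ar C" "Dom C h = H \<otimes>\<^sub>o A" "Cod C h = Y"
  shows "\<epsilon> Y \<cdot> (id\<^sub>m H \<otimes>\<^sub>m adjunct C \<Omega> \<eta> A h) = h"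
  using assms ob_Dom_Cod(2)[of h]
  by (simp add: adjunct_def whisker_left cmp_reduce[OF counit_natural'] counit_susp_unit)

text \<open>The uniqueness half of the universal property: naturality of the unit and a triangle
  identity recover an arrow from its transpose.\<close>

lemma transpose_cancel:
  assumes "\<epsilon> Y \<cdot> (id\<^sub>m H \<otimes>\<^sub>m f) = \<epsilon> Y \<cdot> (id\<^sub>m H \<otimes>\<^sub>m g)"
    and [simp]: "f \<in> ar C" "g \<in> ar C" "Dom C f = Dom C g" "Cod C f = on_ob \<Omega> Y" "Cod C g = on_ob \<Omega> Y" "Y \<in> ob C"
  shows "f = g"
proof -
  have *: "h = on_ar \<Omega> (\<epsilon> Y \<cdot> (id\<^sub>m H \<otimes>\<^sub>m h)) \<cdot> \<eta> (Dom C h)"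
    if [simp]: "h \<in> ar C" "Cod C h = on_ob \<Omega> Y" for h
  proof -
    have "on_ar \<Omega> (\<epsilon> Y \<cdot> (id\<^sub>m H \<otimes>\<^sub>m h)) \<cdot> \<eta> (Dom C h) =
        on_ar \<Omega> (\<epsilon> Y) \<cdot> \<eta> (on_ob \<Omega> Y) \<cdot> h"
      by (simp add: Omega_cmp unit_natural')
    thus ?thesis
      by (simp add: cmp_reduce[OF Omega_counit_unit])
  qed
  show ?thesis
    using *[of f] *[of g] assms by simp
qed

section \<open>The exchange map and its iterates\<close>

abbreviation loop_susp :: "'o \<Rightarrow> 'o"
  where "loop_susp X \<equiv> on_ob \<Omega> (H \<otimes>\<^sub>o X)"

abbreviation exchange :: "'o \<Rightarrow> 'o \<Rightarrow> 'm"
  where "exchange \<equiv> tensor_exchange C H \<Omega> \<eta> \<epsilon>"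

lemma exchange_ar [simp]:
  assumes "A \<in> ob C" "X \<in> ob C"
  shows "exchange A X \<in> ar C" "Dom C (exchange A X) = A \<otimes>\<^sub>o loop_susp X"
    "Cod C (exchange A X) = loop_susp (A \<otimes>\<^sub>o X)"
  using assms by (simp_all add: tensor_exchange_def Let_def)

lemma counit_exchange:
  assumes "A \<in> ob C" "X \<in> ob C"
  shows "\<epsilon> (H \<otimes>\<^sub>o A \<otimes>\<^sub>o X) \<cdot> (id\<^sub>m H \<otimes>\<^sub>m exchange A X) =
    swap_left C A H X \<cdot> (id\<^sub>m A \<otimes>\<^sub>m \<epsilon> (H \<otimes>\<^sub>o X)) \<cdot> swap_left C H A (loop_susp X)"
  using assms by (simp add: tensor_exchange_def Let_def counit_adjunct)

text \<open>The transposes are compared; there \<open>f\<close> and \<open>g\<close> slide through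
  both swaps and the counit by naturality.\<close>

lemma exchange_natural:
  assumes [simp]: "f \<in> ar C" "g \<in> ar C" "Cod C f = A'" "Cod C g = X'"
  shows "exchange A' X' \<cdot> (f \<otimes>\<^sub>m on_ar \<Omega> (id\<^sub>m H \<otimes>\<^sub>m g)) =
    on_ar \<Omega> (id\<^sub>m H \<otimes>\<^sub>m f \<otimes>\<^sub>m g) \<cdot> exchange (Dom C f) (Dom C g)"
proof -
  have [simp]: "A' \<in> ob C" "X' \<in> ob C"
    using assms ob_Dom_Cod(2) by blast+
  let ?A = "Dom C f" and ?X = "Dom C g" and ?Y = "H \<otimes>\<^sub>o A' \<otimes>\<^sub>o X'"
  have *: "(id\<^sub>m A' \<otimes>\<^sub>m \<epsilon> (H \<otimes>\<^sub>o X')) \<cdot> (f \<otimes>\<^sub>m id\<^sub>m H \<otimes>\<^sub>m on_ar \<Omega> (id\<^sub>m H \<otimes>\<^sub>m g)) =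
      (f \<otimes>\<^sub>m id\<^sub>m H \<otimes>\<^sub>m g) \<cdot> (id\<^sub>m ?A \<otimes>\<^sub>m \<epsilon> (H \<otimes>\<^sub>o ?X))"
    by (simp add: interchange counit_natural')
  have "\<epsilon> ?Y \<cdot> (id\<^sub>m H \<otimes>\<^sub>m (exchange A' X' \<cdot> (f \<otimes>\<^sub>m on_ar \<Omega> (id\<^sub>m H \<otimes>\<^sub>m g)))) =
      swap_left C A' H X' \<cdot> (id\<^sub>m A' \<otimes>\<^sub>m \<epsilon> (H \<otimes>\<^sub>o X')) \<cdot> swap_left C H A' (loop_susp X') \<cdot>
      (id\<^sub>m H \<otimes>\<^sub>m f \<otimes>\<^sub>m on_ar \<Omega> (id\<^sub>m H \<otimes>\<^sub>m g))"
    by (simp add: whisker_left cmp_reduce[OF counit_exchange])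
  also have "\<dots> = (id\<^sub>m H \<otimes>\<^sub>m f \<otimes>\<^sub>m g) \<cdot> swap_left C ?A H ?X \<cdot> (id\<^sub>m ?A \<otimes>\<^sub>m \<epsilon> (H \<otimes>\<^sub>o ?X)) \<cdot>
      swap_left C H ?A (loop_susp ?X)"
    by (simp add: swap_natural cmp_reduce[OF swap_natural] cmp_reduce[OF *])
  also have "\<dots> = \<epsilon> ?Y \<cdot> (id\<^sub>m H \<otimes>\<^sub>m (on_ar \<Omega> (id\<^sub>m H \<otimes>\<^sub>m f \<otimes>\<^sub>m g) \<cdot> exchange ?A ?X))"
    by (simp add: whisker_left cmp_reduce[OF counit_natural'] counit_exchange)
  finally show ?thesis
    by (rule transpose_cancel) auto
qed

text \<open>The moved factor \<open>A\<close> is kept apart from the object \<open>H\<close> of the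
  adjunction, so that both \<open>G\<close> and \<open>H\<close> can be moved past the same
  loops.\<close>

primrec iter_exchange :: "'o \<Rightarrow> nat \<Rightarrow> 'o \<Rightarrow> 'm"
  where
    "iter_exchange A 0 X = id\<^sub>m (loop_susp X)"
  | "iter_exchange A (Suc n) X = exchange A (susp_ob A n X) \<cdot> (id\<^sub>m A \<otimes>\<^sub>m iter_exchange A n X)"

lemma iter_exchange [simp]:
  assumes [simp]: "A \<in> ob C" "X \<in> ob C"
  shows "iter_exchange A n X \<in> ar C" "Dom C (iter_exchange A n X) = susp_ob A n (loop_susp X)"
    "Cod C (iter_exchange A n X) = loop_susp (susp_ob A n X)"
  by (induction n) auto

lemma iter_exchange_natural:
  assumes [simp]: "j \<in> ar C" "X \<in> ob C"
  shows "iter_exchange (Cod C j) n X \<cdot> susp_map j n (loop_susp X) =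
    on_ar \<Omega> (id\<^sub>m H \<otimes>\<^sub>m susp_map j n X) \<cdot> iter_exchange (Dom C j) n X"
proof (induction n)
  case (Suc n)
  let ?A = "Dom C j" and ?B = "Cod C j"
  have "iter_exchange ?B (Suc n) X \<cdot> susp_map j (Suc n) (loop_susp X) =
      exchange ?B (susp_ob ?B n X) \<cdot> (j \<otimes>\<^sub>m (iter_exchange ?B n X \<cdot> susp_map j n (loop_susp X)))"
    by (simp add: interchange)
  also have "\<dots> = (exchange ?B (susp_ob ?B n X) \<cdot> (j \<otimes>\<^sub>m on_ar \<Omega> (id\<^sub>m H \<otimes>\<^sub>m susp_map j n X))) \<cdot>
      (id\<^sub>m ?A \<otimes>\<^sub>m iter_exchange ?A n X)"
    by (simp only: Suc) (simp add: interchange)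
  also have "\<dots> = on_ar \<Omega> (id\<^sub>m H \<otimes>\<^sub>m susp_map j (Suc n) X) \<cdot> iter_exchange ?A (Suc n) X"
    by (subst exchange_natural) simp_all
  finally show ?case .
qed simp

text \<open>Transposed, each exchange puts a swap before and a swap after the counit. For
  \<open>A = H\<close> the former accumulate to \<open>cycle\<close> and the latter to
  \<open>cycle_back\<close>.\<close>

lemma counit_iter_exchange:
  assumes [simp]: "X \<in> ob C"
  shows "\<epsilon> (H \<otimes>\<^sub>o susp_ob H n X) \<cdot> (id\<^sub>m H \<otimes>\<^sub>m iter_exchange H n X) =
    cycle_back H n X \<cdot> susp_ar H n (\<epsilon> (H \<otimes>\<^sub>o X)) \<cdot> cycle H n (loop_susp X)"
proof (induction n)
  case (Suc n)
  let ?X = "susp_ob H n X" and ?Y = "susp_ob H n (loop_susp X)"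
  have "\<epsilon> (H \<otimes>\<^sub>o H \<otimes>\<^sub>o ?X) \<cdot> (id\<^sub>m H \<otimes>\<^sub>m iter_exchange H (Suc n) X) =
      swap_left C H H ?X \<cdot> (id\<^sub>m H \<otimes>\<^sub>m \<epsilon> (H \<otimes>\<^sub>o ?X)) \<cdot> swap_left C H H (loop_susp ?X) \<cdot>
      (id\<^sub>m H \<otimes>\<^sub>m id\<^sub>m H \<otimes>\<^sub>m iter_exchange H n X)"
    by (simp add: whisker_left cmp_reduce[OF counit_exchange])
  also have "\<dots> = swap_left C H H ?X \<cdot>
      (id\<^sub>m H \<otimes>\<^sub>m (\<epsilon> (H \<otimes>\<^sub>o ?X) \<cdot> (id\<^sub>m H \<otimes>\<^sub>m iter_exchange H n X))) \<cdot> swap_left C H H ?Y"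
    by (simp add: whisker_left swap_natural)
  also have "\<dots> = cycle_back H (Suc n) X \<cdot> susp_ar H (Suc n) (\<epsilon> (H \<otimes>\<^sub>o X)) \<cdot> cycle H (Suc n) (loop_susp X)"
    by (simp only: Suc) (simp add: whisker_left)
  finally show ?case by simp
qed simp

text \<open>By naturality \<open>\<eta> \<cdot> f\<close> depends only on
  \<open>H \<otimes> f\<close>, so monic units make \<open>H \<otimes> (-)\<close> cancellable, one
  factor at a time.\<close>

lemma susp_faithful:
  assumes eq: "susp_ar H n f = susp_ar H n g"
    and mono: "\<And>n f g. \<lbrakk>\<eta> (susp_ob H n X) \<cdot> f = \<eta> (susp_ob H n X) \<cdot> g; f \<in> ar C; g \<in> ar C;
      Cod C f = susp_ob H n X; Cod C g = susp_ob H n X\<rbrakk> \<Longrightarrow> f = g"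
    and [simp]: "f \<in> ar C" "g \<in> ar C" "Dom C f = Dom C g" "Cod C f = H \<otimes>\<^sub>o X" "Cod C g = H \<otimes>\<^sub>o X" "X \<in> ob C"
  shows "f = g"
  using eq
proof (induction n)
  case (Suc n)
  \<comment> \<open>Both arrows end in \<open>susp_ob H n (H \<otimes>\<^sub>o X)\<close>, which
    equals \<open>susp_ob H (Suc n) X\<close>; hence the shifted index.\<close>
  have "\<eta> (susp_ob H (Suc n) X) \<cdot> susp_ar H n f = \<eta> (susp_ob H (Suc n) X) \<cdot> susp_ar H n g"
    using Suc.prems by (simp add: unit_natural')
  hence "susp_ar H n f = susp_ar H n g"
    by (rule mono[of "Suc n"]) auto
  thus ?case
    by (rule Suc.IH)
qed simp

text \<open>In \<open>r_exchange\<close> the moved factor is \<open>G\<close> while the loops belong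
  to \<open>H\<close>: \<open>S\<close> is closed under suspension by the former, but the adjunction
  is that of the latter.\<close>

lemma unit_iso:
  assumes S: "S \<subseteq> ob C" "\<And>X. X \<in> S \<Longrightarrow> G \<otimes>\<^sub>o X \<in> S"
    and G [simp]: "G \<in> ob C"
    and r: "\<And>X. X \<in> S \<Longrightarrow> r X \<in> Hom (loop_susp X) X"
    and r_unit: "\<And>X. X \<in> S \<Longrightarrow> r X \<cdot> \<eta> X = id\<^sub>m X"
    and r_exchange: "\<And>X. X \<in> S \<Longrightarrow> id\<^sub>m G \<otimes>\<^sub>m r X = r (G \<otimes>\<^sub>o X) \<cdot> exchange G X"
    and j: "j \<in> Hom H G" "q \<in> Hom G H" "q \<cdot> j = id\<^sub>m H"
    and sym: "symmetric_object C H"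
    and X: "X \<in> S"
  shows "is_isomorphism C (\<eta> X)"
proof -
  note [simp] = HomD[OF j(1)] HomD[OF j(2)]
  have S_ob [simp]: "Y \<in> ob C" if "Y \<in> S" for Y
    using S that by auto
  note [simp] = S(2)
  have S_susp [simp]: "susp_ob G n X \<in> S" for n
    using S X by (induction n) auto
  have r_ar [simp]: "r Y \<in> ar C" "Dom C (r Y) = loop_susp Y" "Cod C (r Y) = Y" if "Y \<in> S" for Y
    using HomD[OF r[OF that]] by auto
  note [simp] = X
  let ?J = "\<lambda>n. susp_map j n X"
  \<comment> \<open>\<open>S\<close> need not contain \<open>susp_ob H n X\<close>, so equations
    there are tested in \<open>susp_ob G n X\<close>, along a split monomorphism.\<close>
  have susp_map_cancel: "f = g" if "?J n \<cdot> f = ?J n \<cdot> g" "f \<in> ar C" "g \<in> ar C"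
    "Cod C f = susp_ob H n X" "Cod C g = susp_ob H n X" for n f g
    by (rule retraction_cancel[of "susp_map q n X" "?J n"])
      (use that in \<open>simp_all add: susp_map_retraction j\<close>)
  have mono: "f = g" if "\<eta> (susp_ob H n X) \<cdot> f = \<eta> (susp_ob H n X) \<cdot> g" "f \<in> ar C" "g \<in> ar C"
    "Cod C f = susp_ob H n X" "Cod C g = susp_ob H n X" for n f g
  proof (rule susp_map_cancel)
    \<comment> \<open>\<open>r\<close> retracts the unit at \<open>susp_ob G n X\<close>. By
      naturality the split monomorphism \<open>?J n\<close> factors through the unit at
      \<open>susp_ob H n X\<close>, which is therefore monic.\<close>
    have *: "r (susp_ob G n X) \<cdot> on_ar \<Omega> (id\<^sub>m H \<otimes>\<^sub>m ?J n) \<cdot> \<eta> (susp_ob H n X) = ?J n"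
      using cmp_reduce[OF r_unit[of "susp_ob G n X"], of "?J n"]
      by (simp add: unit_natural')
    have "?J n \<cdot> h = r (susp_ob G n X) \<cdot> on_ar \<Omega> (id\<^sub>m H \<otimes>\<^sub>m ?J n) \<cdot> \<eta> (susp_ob H n X) \<cdot> h"
      if "h \<in> ar C" "Cod C h = susp_ob H n X" for h
      by (subst *[symmetric]) (use that in simp)
    thus "?J n \<cdot> f = ?J n \<cdot> g"
      using that by simp
  qed (use that in auto)
  have r_iter: "susp_ar G n (r X) = r (susp_ob G n X) \<cdot> iter_exchange G n X" for n
  proof (induction n)
    case (Suc n)
    show ?case
      by (simp add: Suc whisker_left r_exchange)
  qed simp
  obtain n where n: "\<And>Y. Y \<in> ob C \<Longrightarrow> cycle H (Suc n) Y = id\<^sub>m (H \<otimes>\<^sub>o H \<otimes>\<^sub>o susp_ob H n Y)"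
    using cycle_symmetric_object[OF H_ob sym] by metis
  let ?N = "Suc n"
  let ?e = "susp_ar H n (\<epsilon> (H \<otimes>\<^sub>o X))"
  \<comment> \<open>\<open>cycle_back\<close> is a left inverse of \<open>cycle\<close>, which is
    the identity at this index.\<close>
  have rot_back: "cycle_back H ?N X = id\<^sub>m (H \<otimes>\<^sub>o H \<otimes>\<^sub>o susp_ob H n X)"
    using cycle_back_cycle[of H X ?N] n[of X] cycle_back[of H X ?N]
    by (simp del: cycle.simps cycle_back.simps)
  have "\<epsilon> (susp_ob H (Suc ?N) X) \<cdot> (id\<^sub>m H \<otimes>\<^sub>m iter_exchange H ?N X) = id\<^sub>m H \<otimes>\<^sub>m ?e"
    using counit_iter_exchange[of X ?N] n[of "loop_susp X"] rot_back
    by (simp del: cycle.simps cycle_back.simps iter_exchange.simps)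
  \<comment> \<open>With trivial cycles the counit sits at the innermost place and the outermost
    \<open>H\<close> is untouched. By a triangle identity an arrow \<open>H \<otimes> e\<close> is
    the transpose of \<open>\<eta> \<cdot> e\<close>.\<close>
  also have "\<dots> = \<epsilon> (susp_ob H (Suc ?N) X) \<cdot> (id\<^sub>m H \<otimes>\<^sub>m (\<eta> (susp_ob H ?N X) \<cdot> ?e))"
    by (simp add: whisker_left cmp_reduce[OF counit_susp_unit])
  finally have iter: "iter_exchange H ?N X = \<eta> (susp_ob H ?N X) \<cdot> ?e"
    by (rule transpose_cancel) (simp_all del: iter_exchange.simps)
  \<comment> \<open>\<open>r_iter\<close> concerns factors \<open>G\<close>, so the suspended
    \<open>r X\<close> is first carried along \<open>?J ?N\<close>;
    \<open>iter_exchange_natural\<close> then brings the exchange back to factors \<open>H\<close>,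
    where \<open>iter\<close> applies.\<close>
  have "?J ?N \<cdot> susp_ar H ?N (r X) = r (susp_ob G ?N X) \<cdot> iter_exchange G ?N X \<cdot> susp_map j ?N (loop_susp X)"
    using susp_map_natural[of j "r X" ?N] r_iter[of ?N]
    by (simp del: iter_exchange.simps susp_ar.simps susp_ob.simps susp_map.simps)
  also have "\<dots> = r (susp_ob G ?N X) \<cdot> on_ar \<Omega> (id\<^sub>m H \<otimes>\<^sub>m ?J ?N) \<cdot> \<eta> (susp_ob H ?N X) \<cdot> ?e"
    using iter_exchange_natural[of j X ?N] iter
    by (simp del: iter_exchange.simps susp_ar.simps susp_ob.simps susp_map.simps)
  also have "\<dots> = r (susp_ob G ?N X) \<cdot> \<eta> (susp_ob G ?N X) \<cdot> ?J ?N \<cdot> ?e"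
    using cmp_reduce[OF unit_natural'[of "?J ?N" "susp_ob G ?N X"]]
    by (simp del: susp_ar.simps susp_map.simps)
  also have "\<dots> = ?J ?N \<cdot> ?e"
    using cmp_reduce[OF r_unit[of "susp_ob G ?N X"]]
    by (simp del: susp_ar.simps susp_map.simps)
  finally have "susp_ar H ?N (r X) = ?e"
    by (rule susp_map_cancel) simp_all
  \<comment> \<open>\<open>r X\<close> stands under \<open>n + 1\<close> factors and the counit
    under \<open>n\<close>, so one factor moves inward.\<close>
  hence "susp_ar H n (id\<^sub>m H \<otimes>\<^sub>m r X) = ?e"
    by (simp add: susp_ar_shift)
  hence "id\<^sub>m H \<otimes>\<^sub>m r X = \<epsilon> (H \<otimes>\<^sub>o X)"
    by (rule susp_faithful) (rule mono, assumption+, simp_all)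
  \<comment> \<open>Naturality rewrites the left side as
    \<open>on_ar \<Omega> (id\<^sub>m H \<otimes>\<^sub>m r X)\<close> after a unit; with the counit
    substituted this is the other triangle identity.\<close>
  hence "\<eta> X \<cdot> r X = id\<^sub>m (loop_susp X)"
    by (simp add: unit_natural' Omega_counit_unit)
  thus ?thesis
    by (intro isoI[of _ "r X"]) (simp_all add: r_unit)
qed

end


section \<open>Comparison of two suspension adjunctions along \<open>j\<close> and
  \<open>q\<close>\<close>

locale suspension_adjunctions = additive_symmetric_monoidal_category C +
  G: suspension_adjunction C G \<Omega> \<eta> \<epsilon> + H: suspension_adjunction C H \<Omega>' \<eta>' \<epsilon>'
  for C :: "('o, 'm, 'x) tensor_data_scheme" (structure) and G \<Omega> \<eta> \<epsilon> H \<Omega>' \<eta>' \<epsilon>' +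
  fixes j q :: 'm
  assumes j: "j \<in> Hom H G" and q: "q \<in> Hom G H"
begin

lemmas jq [simp] = HomD(1-3)[OF j] HomD(1-3)[OF q]

abbreviation incl :: "'o \<Rightarrow> 'm"
  where "incl \<equiv> summand_inclusion C \<Omega> \<eta> H \<Omega>' \<epsilon>' j q"

lemma incl_ar [simp]:
  assumes "X \<in> ob C"
  shows "incl X \<in> ar C" "Dom C (incl X) = H.loop_susp X" "Cod C (incl X) = G.loop_susp X"
  using assms by (simp_all add: summand_inclusion_def loop_map_def)

text \<open>\<open>j\<close> comes out by naturality of the counit, while \<open>q\<close> appears
  on transposing \<open>loop_map\<close>.\<close>

lemma counit_incl:
  assumes "X \<in> ob C"
  shows "\<epsilon> (G \<otimes>\<^sub>o X) \<cdot> (id\<^sub>m G \<otimes>\<^sub>m incl X) =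
    (j \<otimes>\<^sub>m id\<^sub>m X) \<cdot> \<epsilon>' (H \<otimes>\<^sub>o X) \<cdot> (q \<otimes>\<^sub>m id\<^sub>m (H.loop_susp X))"
  using assms
  by (simp add: summand_inclusion_def loop_map_def whisker_left cmp_reduce[OF G.counit_natural']
      G.counit_adjunct)

text \<open>Serves to pass from the first hypothesis on \<open>\<rho>\<close> to its restriction
  along \<open>incl\<close>. Transposes are compared; \<open>j\<close> and \<open>q\<close> pass the
  swaps by naturality.\<close>

lemma exchange_incl:
  assumes [simp]: "A \<in> ob C" "X \<in> ob C"
  shows "G.exchange A X \<cdot> (id\<^sub>m A \<otimes>\<^sub>m incl X) = incl (A \<otimes>\<^sub>o X) \<cdot> H.exchange A X"
proof -
  let ?AX = "A \<otimes>\<^sub>o X" and ?T = "H.loop_susp X"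
  have q_natural: "(q \<otimes>\<^sub>m id\<^sub>m (H.loop_susp ?AX)) \<cdot> (id\<^sub>m G \<otimes>\<^sub>m H.exchange A X) =
      (id\<^sub>m H \<otimes>\<^sub>m H.exchange A X) \<cdot> (q \<otimes>\<^sub>m id\<^sub>m A \<otimes>\<^sub>m id\<^sub>m ?T)"
    by (simp add: interchange)
  have swap_G: "swap_left C G A (G.loop_susp X) \<cdot> (id\<^sub>m G \<otimes>\<^sub>m id\<^sub>m A \<otimes>\<^sub>m incl X) =
      (id\<^sub>m A \<otimes>\<^sub>m id\<^sub>m G \<otimes>\<^sub>m incl X) \<cdot> swap_left C G A ?T"
    by (simp add: swap_natural del: tensor_ident')
  have swap_j: "swap_left C A G X \<cdot> (id\<^sub>m A \<otimes>\<^sub>m j \<otimes>\<^sub>m id\<^sub>m X) = (j \<otimes>\<^sub>m id\<^sub>m A \<otimes>\<^sub>m id\<^sub>m X) \<cdot> swap_left C A H X"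
    by (simp add: swap_natural del: tensor_ident')
  \<comment> \<open>Fusing \<open>id\<^sub>m A \<otimes>\<^sub>m id\<^sub>m ?T\<close> into one
    identity would hide the triple product that \<open>swap_natural\<close> has to match.\<close>
  have swap_q: "(id\<^sub>m A \<otimes>\<^sub>m q \<otimes>\<^sub>m id\<^sub>m ?T) \<cdot> swap_left C G A ?T = swap_left C H A ?T \<cdot> (q \<otimes>\<^sub>m id\<^sub>m A \<otimes>\<^sub>m id\<^sub>m ?T)"
    by (simp add: swap_natural del: tensor_ident')
  have "\<epsilon> (G \<otimes>\<^sub>o ?AX) \<cdot> (id\<^sub>m G \<otimes>\<^sub>m (G.exchange A X \<cdot> (id\<^sub>m A \<otimes>\<^sub>m incl X))) =
      swap_left C A G X \<cdot> (id\<^sub>m A \<otimes>\<^sub>m \<epsilon> (G \<otimes>\<^sub>o X)) \<cdot> (id\<^sub>m A \<otimes>\<^sub>m id\<^sub>m G \<otimes>\<^sub>m incl X) \<cdot> swap_left C G A ?T"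
    by (simp add: whisker_left cmp_reduce[OF G.counit_exchange] swap_G)
  also have "\<dots> = swap_left C A G X \<cdot> (id\<^sub>m A \<otimes>\<^sub>m (\<epsilon> (G \<otimes>\<^sub>o X) \<cdot> (id\<^sub>m G \<otimes>\<^sub>m incl X))) \<cdot> swap_left C G A ?T"
    by (simp add: whisker_left)
  \<comment> \<open>\<open>counit_incl\<close> replaces the counit for \<open>G\<close> by the one
    for \<open>H\<close>, placed between \<open>q\<close> and \<open>j\<close>.\<close>
  also have "\<dots> = swap_left C A G X \<cdot> (id\<^sub>m A \<otimes>\<^sub>m j \<otimes>\<^sub>m id\<^sub>m X) \<cdot> (id\<^sub>m A \<otimes>\<^sub>m \<epsilon>' (H \<otimes>\<^sub>o X)) \<cdot>
      (id\<^sub>m A \<otimes>\<^sub>m q \<otimes>\<^sub>m id\<^sub>m ?T) \<cdot> swap_left C G A ?T"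
    by (subst counit_incl) (simp_all add: whisker_left)
  also have "\<dots> = (j \<otimes>\<^sub>m id\<^sub>m ?AX) \<cdot> swap_left C A H X \<cdot> (id\<^sub>m A \<otimes>\<^sub>m \<epsilon>' (H \<otimes>\<^sub>o X)) \<cdot>
      swap_left C H A ?T \<cdot> (q \<otimes>\<^sub>m id\<^sub>m A \<otimes>\<^sub>m id\<^sub>m ?T)"
    using swap_q cmp_reduce[OF swap_j] by simp
  also have "\<dots> = (j \<otimes>\<^sub>m id\<^sub>m ?AX) \<cdot> \<epsilon>' (H \<otimes>\<^sub>o ?AX) \<cdot> (id\<^sub>m H \<otimes>\<^sub>m H.exchange A X) \<cdot>
      (q \<otimes>\<^sub>m id\<^sub>m A \<otimes>\<^sub>m id\<^sub>m ?T)"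
    by (simp add: cmp_reduce[OF H.counit_exchange])
  \<comment> \<open>\<open>q\<close> is moved across the exchange map so that
    \<open>counit_incl\<close> can be read backwards.\<close>
  also have "\<dots> = (j \<otimes>\<^sub>m id\<^sub>m ?AX) \<cdot> \<epsilon>' (H \<otimes>\<^sub>o ?AX) \<cdot> (q \<otimes>\<^sub>m id\<^sub>m (H.loop_susp ?AX)) \<cdot>
      (id\<^sub>m G \<otimes>\<^sub>m H.exchange A X)"
    using q_natural by simp
  also have "\<dots> = \<epsilon> (G \<otimes>\<^sub>o ?AX) \<cdot> (id\<^sub>m G \<otimes>\<^sub>m (incl ?AX \<cdot> H.exchange A X))"
    by (simp add: whisker_left cmp_reduce[OF counit_incl])
  finally show ?thesis
    by (rule G.transpose_cancel) simp_all
qed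

end


section \<open>The cancellation theorem\<close>

theorem proposition2p16:
  fixes C :: "('o, 'm, 'x) tensor_data_scheme" (structure)
    and G Gbar :: 'o
    and i p j q :: 'm
    and \<Omega>\<^sub>G \<Omega>\<^sub>Gbar :: "('o, 'm, 'o, 'm) functor_data"
    and u c ubar cbar :: "'o \<Rightarrow> 'm"
    and S :: "'o set"
    and \<rho> :: "'o \<Rightarrow> 'm"
  assumes "additive_symmetric_monoidal_category C"
    and "G \<in> ob C"
    and "i \<in> Hom \<I> G" and "p \<in> Hom G \<I>" and "p \<cdot> i = id\<^sub>m \<I>"
    and "is_biproduct C \<I> Gbar G i p j q"
    and "adjunction C C (Susp C G) \<Omega>\<^sub>G u c"
    and "adjunction C C (Susp C Gbar) \<Omega>\<^sub>Gbar ubar cbar"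
    and "S \<subseteq> ob C" and "\<I> \<in> S" and "\<And>X. X \<in> S \<Longrightarrow> G \<otimes>\<^sub>o X \<in> S"
    and "\<And>X. X \<in> S \<Longrightarrow> \<rho> X \<in> Hom (on_ob \<Omega>\<^sub>G (G \<otimes>\<^sub>o X)) X"
    and hyp1: "\<And>X. X \<in> S \<Longrightarrow>
      id\<^sub>m G \<otimes>\<^sub>m \<rho> X = \<rho> (G \<otimes>\<^sub>o X) \<cdot> tensor_exchange C G \<Omega>\<^sub>G u c G X"
    and hyp2_i: "\<And>X. X \<in> S \<Longrightarrow>
      from_unit C i X \<cdot> \<rho> X =
      \<rho> (G \<otimes>\<^sub>o X) \<cdot> on_ar \<Omega>\<^sub>G (id\<^sub>m G \<otimes>\<^sub>m from_unit C i X)"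
    and hyp2_p: "\<And>X. X \<in> S \<Longrightarrow>
      to_unit C p X \<cdot> \<rho> (G \<otimes>\<^sub>o X) =
      \<rho> X \<cdot> on_ar \<Omega>\<^sub>G (id\<^sub>m G \<otimes>\<^sub>m to_unit C p X)"
    and hyp3: "\<And>X. X \<in> S \<Longrightarrow>
      \<rho> X \<cdot> summand_inclusion C \<Omega>\<^sub>G u Gbar \<Omega>\<^sub>Gbar cbar j q X \<cdot> ubar X = id\<^sub>m X"
    and hyp4: "symmetric_object C Gbar"
  shows "\<forall>X\<in>S. is_isomorphism C (ubar X)"
proof
  fix X assume X: "X \<in> S"
  interpret additive_symmetric_monoidal_category C by fact
  have jq: "j \<in> Hom Gbar G" "q \<in> Hom G Gbar" "q \<cdot> j = id\<^sub>m Gbar"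
    using \<open>is_biproduct C \<I> Gbar G i p j q\<close> by (simp_all add: is_biproduct_def)
  have "Gbar \<in> ob C"
    using HomD(4)[OF jq(1)] .
  interpret suspension_adjunctions C G \<Omega>\<^sub>G u c Gbar \<Omega>\<^sub>Gbar ubar cbar j q
    by (intro suspension_adjunctions.intro suspension_adjunction.intro suspension_adjunction_axioms.intro
        suspension_adjunctions_axioms.intro) fact+
  \<comment> \<open>The restriction of \<open>\<rho>\<close> to the loops for
    \<open>Gbar\<close>.\<close>
  let ?r = "\<lambda>X. \<rho> X \<cdot> incl X"
  have ob: "Y \<in> ob C" if "Y \<in> S" for Y
    using that \<open>S \<subseteq> ob C\<close> by auto
  have \<rho>: "\<rho> Y \<in> ar C" "Dom C (\<rho> Y) = G.loop_susp Y" "Cod C (\<rho> Y) = Y" if "Y \<in> S" for Y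
    using HomD(1-3)[OF assms(12)[OF that]] by simp_all
  show "is_isomorphism C (ubar X)"
  proof (rule H.unit_iso[where r = ?r and G = G and S = S and j = j and q = q])
    fix Y assume Y: "Y \<in> S"
    note [simp] = \<open>G \<in> ob C\<close> ob[OF Y] \<rho>[OF Y] \<rho>[OF assms(11)[OF Y]]
    show "?r Y \<in> Hom (H.loop_susp Y) Y"
      by (rule HomI) simp_all
    show "?r Y \<cdot> ubar Y = id\<^sub>m Y"
      using hyp3[OF Y] by simp
    have "id\<^sub>m G \<otimes>\<^sub>m ?r Y = (id\<^sub>m G \<otimes>\<^sub>m \<rho> Y) \<cdot> (id\<^sub>m G \<otimes>\<^sub>m incl Y)"
      by (simp add: whisker_left)
    \<comment> \<open>After \<open>hyp1\<close>, \<open>exchange_incl\<close> trades the exchange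
      map of the \<open>G\<close>-adjunction for that of the \<open>Gbar\<close>-adjunction; the
      moved factor remains \<open>G\<close>.\<close>
    also have "\<dots> = ?r (G \<otimes>\<^sub>o Y) \<cdot> H.exchange G Y"
      by (simp add: hyp1[OF Y] exchange_incl)
    finally show "id\<^sub>m G \<otimes>\<^sub>m ?r Y = ?r (G \<otimes>\<^sub>o Y) \<cdot> H.exchange G Y" .
  qed fact+
qed

end
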